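(* For every $k\ge 2$ and every $k$-uniform matching $M$ (of fixed size), the quantity $\mathrm{rem}_M(G)$ can be computed in time polynomial in the number of vertices of the input $k$-graph $G$.
   Context: A $k$-uniform matching is a $k$-graph consisting of pairwise vertex-disjoint edges. For a $k$-graph $F$ and a $k$-graph $G$, $\mathrm{rem}_F(G)$ is the minimum number of edges whose deletion from $G$ yields a $k$-graph containing no copy (subgraph isomorphic to) $F$; equivalently $\mathrm{rem}_F(G)=e(G)-\mathrm{ex}_F(G)$, where $\mathrm{ex}_F(G)$ is the maximum number of edges of a subgraph of $G$ containing no copy of $F$. *)

theory Defs
  imports Main "HOL-Computational_Algebra.Polynomial"
begin

section \<open>Uniform hypergraphs\<close>

datatype 'a hypergraph = Hypergraph (verts: "'a set") (edges: "'a set set")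

definition kgraph :: "nat \<Rightarrow> 'a hypergraph \<Rightarrow> bool" where
  "kgraph k G \<longleftrightarrow> finite (verts G) \<and> (\<forall>e\<in>edges G. e \<subseteq> verts G \<and> card e = k)"

text \<open>A matching consists of its edges, so it has no isolated vertices.\<close>

definition matching :: "nat \<Rightarrow> 'a hypergraph \<Rightarrow> bool" where
  "matching k M \<longleftrightarrow> kgraph k M \<and> verts M = \<Union>(edges M) \<and> pairwise disjnt (edges M)"

definition subgraph :: "'a hypergraph \<Rightarrow> 'a hypergraph \<Rightarrow> bool" where
  "subgraph H G \<longleftrightarrow> verts H \<subseteq> verts G \<and> edges H \<subseteq> edges G \<and> (\<forall>e\<in>edges H. e \<subseteq> verts H)"

definition isomorphic :: "'a hypergraph \<Rightarrow> 'b hypergraph \<Rightarrow> bool" where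
  "isomorphic F H \<longleftrightarrow> (\<exists>f. bij_betw f (verts F) (verts H) \<and> (`) f ` edges F = edges H)"

definition contains_copy :: "'a hypergraph \<Rightarrow> 'b hypergraph \<Rightarrow> bool" where
  "contains_copy F G \<longleftrightarrow> (\<exists>H. subgraph H G \<and> isomorphic F H)"

definition delete_edges :: "'a hypergraph \<Rightarrow> 'a set set \<Rightarrow> 'a hypergraph" where
  "delete_edges G D = Hypergraph (verts G) (edges G - D)"

text \<open>
  The minimum is over a nonempty set as soon as \<open>F\<close> has an edge. If \<open>F\<close> is edgeless and
  \<open>G\<close> has at least as many vertices, nothing can be deleted to destroy all copies of \<open>F\<close>,
  and the value is an unspecified constant.
\<close>

definition rem :: "'a hypergraph \<Rightarrow> 'b hypergraph \<Rightarrow> nat" where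
  "rem F G = (LEAST r. \<exists>D \<subseteq> edges G. card D = r \<and> \<not> contains_copy F (delete_edges G D))"


section \<open>Random access machines and polynomial time\<close>

text \<open>
  A random access machine in the style of Cook and Reckhow and of Papadimitriou: registers
  \<open>R 0, R 1, \<dots>\<close> hold natural numbers, the input is a read-only array, and every instruction
  costs one time unit. There is no multiplication: addition and subtraction let the bit
  length of a number grow by at most one per step, so that unit-cost time is polynomially
  related to Turing machine time.
\<close>

datatype instr =
    Const nat nat       \<comment> \<open>\<open>Const i c\<close>: \<open>R i := c\<close>\<close>
  | Add nat nat nat     \<comment> \<open>\<open>Add i j l\<close>: \<open>R i := R j + R l\<close>\<close>
  | Sub nat nat nat     \<comment> \<open>\<open>Sub i j l\<close>: \<open>R i := R j - R l\<close>, truncated at 0\<close>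
  | Load nat nat        \<comment> \<open>\<open>Load i j\<close>: \<open>R i := R (R j)\<close>\<close>
  | Store nat nat       \<comment> \<open>\<open>Store i j\<close>: \<open>R (R i) := R j\<close>\<close>
  | Read nat nat        \<comment> \<open>\<open>Read i j\<close>: \<open>R i :=\<close> input cell number \<open>R j\<close>, or 0 past the end\<close>
  | Jump nat            \<comment> \<open>\<open>Jump a\<close>: continue at address \<open>a\<close>\<close>
  | JumpZero nat nat    \<comment> \<open>\<open>JumpZero j a\<close>: continue at address \<open>a\<close> if \<open>R j = 0\<close>\<close>

type_synonym config = "nat \<times> (nat \<Rightarrow> nat)"  \<comment> \<open>program counter and register contents\<close>

fun exec :: "nat list \<Rightarrow> instr \<Rightarrow> config \<Rightarrow> config" where
  "exec xs (Const i c) (pc, R) = (Suc pc, R(i := c))"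
| "exec xs (Add i j l) (pc, R) = (Suc pc, R(i := R j + R l))"
| "exec xs (Sub i j l) (pc, R) = (Suc pc, R(i := R j - R l))"
| "exec xs (Load i j) (pc, R) = (Suc pc, R(i := R (R j)))"
| "exec xs (Store i j) (pc, R) = (Suc pc, R(R i := R j))"
| "exec xs (Read i j) (pc, R) = (Suc pc, R(i := (if R j < length xs then xs ! R j else 0)))"
| "exec xs (Jump a) (pc, R) = (a, R)"
| "exec xs (JumpZero j a) (pc, R) = ((if R j = 0 then a else Suc pc), R)"

text \<open>The machine halts when the program counter leaves the program.\<close>

definition step :: "instr list \<Rightarrow> nat list \<Rightarrow> config \<Rightarrow> config" where
  "step P xs c = (if fst c < length P then exec xs (P ! fst c) c else c)"

text \<open>Started at address 0 with all registers 0, program \<open>P\<close> on input \<open>xs\<close> halts after at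
  most \<open>t\<close> steps with \<open>y\<close> in register 0.\<close>

definition outputs_within :: "instr list \<Rightarrow> nat list \<Rightarrow> nat \<Rightarrow> nat \<Rightarrow> bool" where
  "outputs_within P xs t y \<longleftrightarrow>
     (case (step P xs ^^ t) (0, \<lambda>_. 0) of (pc, R) \<Rightarrow> length P \<le> pc \<and> R 0 = y)"

text \<open>
  \<open>f\<close> is computable on the instances in \<open>I\<close> in time polynomial in the parameter \<open>s\<close>. An
  instance may have several encodings; the program has to succeed on all of them.
\<close>

definition poly_time_computable ::
  "'i set \<Rightarrow> ('i \<Rightarrow> nat list \<Rightarrow> bool) \<Rightarrow> ('i \<Rightarrow> nat) \<Rightarrow> ('i \<Rightarrow> nat) \<Rightarrow> bool" where
  "poly_time_computable I encodes s f \<longleftrightarrow>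
     (\<exists>P (p :: nat poly). \<forall>x\<in>I. \<forall>xs. encodes x xs \<longrightarrow>
        outputs_within P xs (poly p (s x)) (f x))"


section \<open>Input \<open>k\<close>-graphs\<close>

definition input_kgraphs :: "nat \<Rightarrow> nat hypergraph set" where
  "input_kgraphs k = {G. kgraph k G \<and> (\<exists>n. verts G = {..<n})}"

text \<open>
  An input word for \<open>G\<close> consists of the number of vertices, the number of edges, and then the
  edges, each listed once, as blocks of vertices; the order of the edges and the order of
  the vertices within an edge are arbitrary.
\<close>

definition edge_list_encoding :: "nat hypergraph \<Rightarrow> nat list \<Rightarrow> bool" where
  "edge_list_encoding G xs \<longleftrightarrow>
     (\<exists>es. distinct (map set es) \<and> set (map set es) = edges G \<and> (\<forall>vs\<in>set es. distinct vs) \<and>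
           xs = card (verts G) # length es # concat es)"

end

theory Submission
  imports Defs "HOL-Library.Disjoint_Sets" "HOL-Library.FuncSet"
begin

text \<open>
  Let \<open>s\<close> be the number of edges of \<open>M\<close>. If a \<open>k\<close>-graph \<open>H\<close> has no \<open>s\<close> pairwise disjoint edges,
  then this is already witnessed on a vertex set \<open>T\<close> of size bounded in terms of \<open>k\<close> and \<open>s\<close>: even
  the traces of the edges on \<open>T\<close> contain no \<open>s\<close> pairwise disjoint sets. Conversely, if \<open>\<B>\<close> is a
  family of subsets of \<open>{..<L}\<close> without \<open>s\<close> pairwise disjoint members and \<open>h\<close> maps \<open>{..<L}\<close> to the
  vertices, then the edges containing some \<open>h ` b\<close> with \<open>b \<in> \<B>\<close> form an \<open>M\<close>-free subgraph. Hence
  \<open>rem M G\<close> is the least number of edges left uncovered by such a pair \<open>(\<B>, h)\<close>. There are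
  boundedly many \<open>\<B>\<close>, which are built into the program, and \<open>n ^ L\<close> maps \<open>h\<close>, which it enumerates
  by \<open>L\<close> nested loops.
\<close>

section \<open>Kernels of hypergraphs without large matchings\<close>

text \<open>Members are chosen by index, and the empty set may be chosen for several indices at
  once. Hence one empty trace already gives a rainbow matching of a constant family.\<close>

definition rainbow_matching :: "nat \<Rightarrow> (nat \<Rightarrow> 'a set set) \<Rightarrow> bool" where
  "rainbow_matching s F \<longleftrightarrow> (\<exists>e. (\<forall>i<s. e i \<in> F i) \<and> disjoint_family_on e {..<s})"

lemma rainbow_matchingI:
  "\<forall>i<s. e i \<in> F i \<Longrightarrow> disjoint_family_on e {..<s} \<Longrightarrow> rainbow_matching s F"
  unfolding rainbow_matching_def by blast

text \<open>Take \<open>I\<close> maximal by inclusion among the index sets that admit a disjoint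
  choice. It misses some \<open>j\<close>, and a member of \<open>F j\<close> disjoint from all
  chosen sets could be added, contradicting maximality.\<close>

lemma maximal_partial_rainbow_matching:
  assumes "\<not> rainbow_matching s F"
  obtains I e j where "I \<subseteq> {..<s}" "\<forall>i\<in>I. e i \<in> F i" "j < s" "j \<notin> I"
    "\<forall>x\<in>F j. x \<inter> (\<Union>i\<in>I. e i) \<noteq> {}"
proof -
  define Q where "Q I \<longleftrightarrow> I \<subseteq> {..<s} \<and> (\<exists>e. (\<forall>i\<in>I. e i \<in> F i) \<and> disjoint_family_on e I)" for I
  have "finite (Collect Q)"
    by (rule finite_subset[of _ "Pow {..<s}"]) (auto simp: Q_def)
  moreover have "Q {}" by (simp add: Q_def disjoint_family_on_def)
  ultimately obtain I where I: "Q I" "\<forall>J\<in>Collect Q. I \<subseteq> J \<longrightarrow> I = J"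
    using finite_has_maximal2[of "Collect Q" "{}"] by auto
  obtain e where e: "I \<subseteq> {..<s}" "\<forall>i\<in>I. e i \<in> F i" "disjoint_family_on e I"
    using I(1) by (auto simp: Q_def)
  have "I \<noteq> {..<s}" using e assms by (auto simp: rainbow_matching_def)
  then obtain j where j: "j < s" "j \<notin> I" using e(1) by auto
  have "x \<inter> (\<Union>i\<in>I. e i) \<noteq> {}" if x: "x \<in> F j" for x
  proof
    assume disj: "x \<inter> (\<Union>i\<in>I. e i) = {}"
    have "disjoint_family_on (e(j := x)) (insert j I)"
      using e(3) disj j by (fastforce simp: disjoint_family_on_def)
    then have "Q (insert j I)"
      unfolding Q_def using e j x by (intro conjI exI[of _ "e(j := x)"]) auto
    then show False using I(2) j by auto
  qed
  then show ?thesis using e j by (intro that[of I e j]) auto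
qed

text \<open>The rainbow form lets the induction on the total rank branch over the traces on a maximal
  partial matching: the family that the matching misses loses a vertex in every branch.\<close>

lemma rainbow_kernel:
  "\<exists>L. \<forall>(F :: nat \<Rightarrow> 'a set set) k. (\<forall>i<s. \<forall>e\<in>F i. finite e \<and> card e \<le> k i) \<longrightarrow> (\<Sum>i<s. k i) \<le> N \<longrightarrow>
     \<not> rainbow_matching s F \<longrightarrow>
     (\<exists>T. finite T \<and> card T \<le> L \<and> T \<subseteq> (\<Union>i<s. \<Union>(F i)) \<and>
          \<not> rainbow_matching s (\<lambda>i. (\<lambda>e. e \<inter> T) ` F i))"
proof (induction N)
  case 0
  show ?case
  proof (intro exI[of _ 0] allI impI)
    fix F :: "nat \<Rightarrow> 'a set set" and k
    assume F: "\<forall>i<s. \<forall>e\<in>F i. finite e \<and> card e \<le> k i" "(\<Sum>i<s. k i) \<le> 0" "\<not> rainbow_matching s F"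
    \<comment> \<open>Total rank 0 forces every member to be empty, so tracing on the empty set
      changes nothing.\<close>
    have "(\<lambda>e. e \<inter> {}) ` F i = F i" if "i < s" for i
      using F(1,2) that by (force simp: image_iff)
    then have "\<not> rainbow_matching s (\<lambda>i. (\<lambda>e. e \<inter> {}) ` F i)"
      using F(3) unfolding rainbow_matching_def by metis
    then show "\<exists>T. finite T \<and> card T \<le> 0 \<and> T \<subseteq> (\<Union>i<s. \<Union>(F i)) \<and>
          \<not> rainbow_matching s (\<lambda>i. (\<lambda>e. e \<inter> T) ` F i)"
      by (intro exI[of _ "{}"]) auto
  qed
next
  case (Suc N)
  then obtain L where L: "\<forall>(F :: nat \<Rightarrow> 'a set set) k. (\<forall>i<s. \<forall>e\<in>F i. finite e \<and> card e \<le> k i) \<longrightarrow>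
     (\<Sum>i<s. k i) \<le> N \<longrightarrow> \<not> rainbow_matching s F \<longrightarrow>
     (\<exists>T. finite T \<and> card T \<le> L \<and> T \<subseteq> (\<Union>i<s. \<Union>(F i)) \<and>
          \<not> rainbow_matching s (\<lambda>i. (\<lambda>e. e \<inter> T) ` F i))" by (elim exE)
  show ?case
  \<comment> \<open>\<open>Suc N\<close> bounds the union \<open>U\<close> of a maximal partial
    matching, \<open>(2 ^ Suc N) ^ s\<close> the number of ways to prescribe traces on
    \<open>U\<close>, and \<open>L\<close> the kernel of each such branch.\<close>
  proof (intro exI[of _ "Suc N + (2 ^ Suc N) ^ s * L"] allI impI)
    fix F :: "nat \<Rightarrow> 'a set set" and k
    assume F: "\<forall>i<s. \<forall>e\<in>F i. finite e \<and> card e \<le> k i" "(\<Sum>i<s. k i) \<le> Suc N" "\<not> rainbow_matching s F"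
    obtain I e j where I: "I \<subseteq> {..<s}" "\<forall>i\<in>I. e i \<in> F i" and j: "j < s" "j \<notin> I"
      and meets: "\<forall>x\<in>F j. x \<inter> (\<Union>i\<in>I. e i) \<noteq> {}"
      using maximal_partial_rainbow_matching[OF F(3)] by metis
    define U where "U = (\<Union>i\<in>I. e i)"
    have finI: "finite I" using I(1) finite_subset by blast
    have finU: "finite U" using I F(1) finI by (auto simp: U_def)
    have "card U \<le> (\<Sum>i\<in>I. card (e i))" unfolding U_def by (rule card_UN_le[OF finI])
    also have "\<dots> \<le> (\<Sum>i\<in>I. k i)" using I F(1) by (intro sum_mono) auto
    also have "\<dots> \<le> (\<Sum>i<s. k i)" using I by (intro sum_mono2) auto
    finally have cardU: "card U \<le> Suc N" using F(2) by simp
    define A where "A = PiE {..<s} (\<lambda>_. Pow U)"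
    have finA: "finite A" unfolding A_def using finU by (intro finite_PiE) auto
    have "card A = (2 ^ card U) ^ s" unfolding A_def using finU by (simp add: card_PiE card_Pow)
    also have "\<dots> \<le> (2 ^ Suc N) ^ s" using cardU by (intro power_mono power_increasing) auto
    finally have cardA: "card A \<le> (2 ^ Suc N) ^ s" .
    define link where "link a i = (\<lambda>e. e - U) ` {e \<in> F i. e \<inter> U = a i}" for a :: "nat \<Rightarrow> 'a set" and i
    \<comment> \<open>Only branches with disjoint prescribed traces need a kernel: no other branch
      can come from a rainbow matching.\<close>
    define good where "good a T \<longleftrightarrow> finite T \<and> card T \<le> L \<and> T \<subseteq> (\<Union>i<s. \<Union>(F i)) \<and>
        (disjoint_family_on a {..<s} \<longrightarrow> \<not> rainbow_matching s (\<lambda>i. (\<lambda>e. e \<inter> T) ` link a i))" for a T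
    have kernel: "\<exists>T. good a T"
      if a: "a \<in> A" for a
    proof (cases "disjoint_family_on a {..<s} \<and> link a j \<noteq> {}")
      case False
      \<comment> \<open>Either the condition on \<open>a\<close> is void or index \<open>j\<close>
        has nothing to choose from; the empty kernel serves both cases.\<close>
      then have "good a {}" using j(1) by (auto simp: good_def rainbow_matching_def)
      then show ?thesis by blast
    next
      case True
      then obtain x where x: "x \<in> F j" "x \<inter> U = a j" by (auto simp: link_def)
      \<comment> \<open>Every member of \<open>F j\<close> meets \<open>U\<close>, so passing to
        \<open>link a j\<close> removes at least one vertex from each. This lowers the total
        rank.\<close>
      have aj: "a j \<noteq> {}" using x meets by (auto simp: U_def)
      have "card x > 0" using x aj F(1) j(1) by (auto simp: card_gt_0_iff)
      then have kj: "k j > 0" using F(1) x(1) j(1) by (metis less_le_trans)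
      have "(\<Sum>i<s. k i) = k j + sum k ({..<s} - {j})" using j by (intro sum.remove) auto
      moreover have "(\<Sum>i<s. (k(j := k j - 1)) i) = (k j - 1) + sum k ({..<s} - {j})"
        using j by (subst sum.remove[of _ j]) auto
      ultimately have sum: "(\<Sum>i<s. (k(j := k j - 1)) i) \<le> N" using F(2) kj by linarith
      have rank: "\<forall>i<s. \<forall>y\<in>link a i. finite y \<and> card y \<le> (k(j := k j - 1)) i"
      proof (intro allI impI ballI)
        fix i y assume iy: "i < s" "y \<in> link a i"
        then obtain z where z: "z \<in> F i" "z \<inter> U = a i" "y = z - U" by (auto simp: link_def)
        have fz: "finite z" "card z \<le> k i" using F(1) z iy by auto
        have "card y < card z" if "i = j"
          using z fz aj that by (intro psubset_card_mono) auto
        moreover have "card y \<le> card z" using z fz by (intro card_mono) auto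
        ultimately show "finite y \<and> card y \<le> (k(j := k j - 1)) i" using fz z by auto
      qed
      \<comment> \<open>A rainbow matching of the links would lift to one of \<open>F\<close>: the
        lifted members are disjoint inside \<open>U\<close> because the sets \<open>a i\<close> are,
        and outside \<open>U\<close> because the links are.\<close>
      have free: "\<not> rainbow_matching s (link a)"
      proof
        assume "rainbow_matching s (link a)"
        then obtain y where y: "\<forall>i<s. y i \<in> link a i" "disjoint_family_on y {..<s}"
          by (auto simp: rainbow_matching_def)
        have "\<forall>i. \<exists>z. i < s \<longrightarrow> z \<in> F i \<and> z \<inter> U = a i \<and> y i = z - U"
          using y(1) by (fastforce simp: link_def)
        then obtain z where z: "\<forall>i<s. z i \<in> F i \<and> z i \<inter> U = a i \<and> y i = z i - U"
          by metis
        have "disjoint_family_on z {..<s}"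
          unfolding disjoint_family_on_def
        proof (intro ballI impI)
          fix m n assume mn: "m \<in> {..<s}" "n \<in> {..<s}" "m \<noteq> n"
          then have "a m \<inter> a n = {}" "y m \<inter> y n = {}"
            using True y(2) by (auto simp: disjoint_family_on_def)
          then show "z m \<inter> z n = {}" using z mn by blast
        qed
        then show False using F(3) z by (auto simp: rainbow_matching_def)
      qed
      obtain T where T: "finite T" "card T \<le> L" "T \<subseteq> (\<Union>i<s. \<Union>(link a i))"
        "\<not> rainbow_matching s (\<lambda>i. (\<lambda>e. e \<inter> T) ` link a i)"
        using L[THEN spec, THEN spec, THEN mp, THEN mp, THEN mp, OF rank sum free] by (elim exE conjE) (rule that)
      have "(\<Union>i<s. \<Union>(link a i)) \<subseteq> (\<Union>i<s. \<Union>(F i))" by (auto simp: link_def)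
      then have "T \<subseteq> (\<Union>i<s. \<Union>(F i))" using T(3) by (rule order_trans[rotated])
      with T have "good a T" by (simp add: good_def)
      then show ?thesis by blast
    qed
    then obtain t where "\<And>a. a \<in> A \<Longrightarrow> good a (t a)" by metis
    then have t: "\<And>a. a \<in> A \<Longrightarrow> finite (t a) \<and> card (t a) \<le> L \<and> t a \<subseteq> (\<Union>i<s. \<Union>(F i)) \<and>
        (disjoint_family_on a {..<s} \<longrightarrow> \<not> rainbow_matching s (\<lambda>i. (\<lambda>e. e \<inter> t a) ` link a i))"
      unfolding good_def .
    define T where "T = U \<union> (\<Union>a\<in>A. t a)"
    have "card T \<le> card U + card (\<Union>a\<in>A. t a)" unfolding T_def by (rule card_Un_le)
    also have "card (\<Union>a\<in>A. t a) \<le> (\<Sum>a\<in>A. card (t a))" by (rule card_UN_le[OF finA])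
    also have "(\<Sum>a\<in>A. card (t a)) \<le> card A * L" 
      using t by (intro order_trans[OF sum_bounded_above[where K = L]]) auto
    also have "card A * L \<le> (2 ^ Suc N) ^ s * L" using cardA by (intro mult_right_mono) auto
    finally have "card T \<le> Suc N + (2 ^ Suc N) ^ s * L" using cardU by simp
    moreover have "finite T"
    proof -
      have "finite (t a)" if "a \<in> A" for a using t[OF that] by (elim conjE)
      then show ?thesis using finU finA by (simp add: T_def)
    qed
    moreover have "T \<subseteq> (\<Union>i<s. \<Union>(F i))"
    proof -
      have "t a \<subseteq> (\<Union>i<s. \<Union>(F i))" if "a \<in> A" for a using t[OF that] by (elim conjE)
      moreover have "U \<subseteq> (\<Union>i<s. \<Union>(F i))" using I unfolding U_def by blast
      ultimately show ?thesis unfolding T_def by (intro Un_least UN_least)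
    qed
    \<comment> \<open>A rainbow matching of the traces on \<open>T\<close> determines a branch
      \<open>a\<close> by its traces on \<open>U\<close>. Restricted to \<open>t a\<close> outside
      \<open>U\<close>, it would be a rainbow matching that \<open>t a\<close> was chosen to
      exclude.\<close>
    moreover have "\<not> rainbow_matching s (\<lambda>i. (\<lambda>e. e \<inter> T) ` F i)"
    proof
      assume "rainbow_matching s (\<lambda>i. (\<lambda>e. e \<inter> T) ` F i)"
      then obtain y where y: "\<forall>i<s. y i \<in> (\<lambda>e. e \<inter> T) ` F i" "disjoint_family_on y {..<s}"
        by (auto simp: rainbow_matching_def)
      have "\<forall>i. \<exists>z. i < s \<longrightarrow> z \<in> F i \<and> y i = z \<inter> T" using y(1) by fastforce
      then obtain z where z: "\<forall>i<s. z i \<in> F i \<and> y i = z i \<inter> T" by metis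
      define a where "a = restrict (\<lambda>i. z i \<inter> U) {..<s}"
      have aA: "a \<in> A" by (auto simp: a_def A_def)
      have UT: "U \<subseteq> T" "t a \<subseteq> T" using aA by (auto simp: T_def)
      have disj: "y m \<inter> y n = {}" if "m < s" "n < s" "m \<noteq> n" for m n
        using y(2) that by (auto simp: disjoint_family_on_def)
      have disjz: "z m \<inter> z n \<inter> T = {}" if "m < s" "n < s" "m \<noteq> n" for m n
        using disj[OF that] z that by blast
      have disja: "disjoint_family_on a {..<s}"
        unfolding disjoint_family_on_def
      proof (intro ballI impI)
        fix m n assume "m \<in> {..<s}" "n \<in> {..<s}" "m \<noteq> n"
        then show "a m \<inter> a n = {}" using disjz[of m n] UT(1) by (auto simp: a_def)
      qed
      have "disjoint_family_on (\<lambda>i. (z i - U) \<inter> t a) {..<s}"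
        unfolding disjoint_family_on_def
      proof (intro ballI impI)
        fix m n assume "m \<in> {..<s}" "n \<in> {..<s}" "m \<noteq> n"
        then show "(z m - U) \<inter> t a \<inter> ((z n - U) \<inter> t a) = {}" using disjz[of m n] UT(2) by auto
      qed
      moreover have "\<forall>i<s. (z i - U) \<inter> t a \<in> (\<lambda>e. e \<inter> t a) ` link a i"
        using z by (auto simp: link_def a_def)
      ultimately have "rainbow_matching s (\<lambda>i. (\<lambda>e. e \<inter> t a) ` link a i)"
        by (intro rainbow_matchingI)
      moreover have "disjoint_family_on a {..<s} \<longrightarrow> \<not> rainbow_matching s (\<lambda>i. (\<lambda>e. e \<inter> t a) ` link a i)"
        using t[OF aA] by (elim conjE)
      ultimately show False using disja by (elim impE notE)
    qed
    ultimately show "\<exists>T. finite T \<and> card T \<le> Suc N + (2 ^ Suc N) ^ s * L \<and> T \<subseteq> (\<Union>i<s. \<Union>(F i)) \<and>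
          \<not> rainbow_matching s (\<lambda>i. (\<lambda>e. e \<inter> T) ` F i)" by (intro exI[of _ T] conjI)
  qed
qed

text \<open>A constant family with rank bound \<open>k\<close> at each of the \<open>s\<close>
  indices has total rank at most \<open>s * k\<close>.\<close>

corollary matching_kernel:
  fixes k s :: nat
  shows "\<exists>L. \<forall>E :: 'a set set. (\<forall>e\<in>E. finite e \<and> card e \<le> k) \<longrightarrow> \<not> rainbow_matching s (\<lambda>_. E) \<longrightarrow>
    (\<exists>T. finite T \<and> card T \<le> L \<and> T \<subseteq> \<Union>E \<and> \<not> rainbow_matching s (\<lambda>_. (\<lambda>e. e \<inter> T) ` E))"
proof -
  obtain L where L: "\<forall>(F :: nat \<Rightarrow> 'a set set) k'. (\<forall>i<s. \<forall>e\<in>F i. finite e \<and> card e \<le> k' i) \<longrightarrow>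
     (\<Sum>i<s. k' i) \<le> s * k \<longrightarrow> \<not> rainbow_matching s F \<longrightarrow>
     (\<exists>T. finite T \<and> card T \<le> L \<and> T \<subseteq> (\<Union>i<s. \<Union>(F i)) \<and>
          \<not> rainbow_matching s (\<lambda>i. (\<lambda>e. e \<inter> T) ` F i))"
    using rainbow_kernel[where 'a = 'a, of s "s * k"] by (rule exE)
  show ?thesis
  proof (intro exI[of _ L] allI impI)
    fix E :: "'a set set" assume E: "\<forall>e\<in>E. finite e \<and> card e \<le> k" "\<not> rainbow_matching s (\<lambda>_. E)"
    have "\<exists>T. finite T \<and> card T \<le> L \<and> T \<subseteq> (\<Union>i<s. \<Union>E) \<and>
          \<not> rainbow_matching s (\<lambda>i. (\<lambda>e. e \<inter> T) ` E)"
      using L[THEN spec, of "\<lambda>_. E", THEN spec, of "\<lambda>_. k"] E by simp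
    then obtain T where T: "finite T" "card T \<le> L" "T \<subseteq> (\<Union>i<s. \<Union>E)"
      "\<not> rainbow_matching s (\<lambda>_. (\<lambda>e. e \<inter> T) ` E)" by (elim exE conjE)
    \<comment> \<open>For \<open>s = 0\<close> the indexed union is empty; otherwise it equals
      \<open>\<Union>E\<close>.\<close>
    then have "T \<subseteq> \<Union>E" by (auto split: if_splits)
    with T show "\<exists>T. finite T \<and> card T \<le> L \<and> T \<subseteq> \<Union>E \<and> \<not> rainbow_matching s (\<lambda>_. (\<lambda>e. e \<inter> T) ` E)"
      by (intro exI[of _ T]) simp
  qed
qed

section \<open>Copies of matchings, and patterns for matching-free edge sets\<close>

text \<open>Since \<open>M\<close> has no isolated vertices, a copy is determined by where the edges
  go: disjoint edges of \<open>G\<close> carry a vertex bijection glued from one bijection per edge.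
  Conversely, an injective map keeps disjoint edges disjoint.\<close>

lemma contains_copy_matching_iff:
  fixes M :: "'a hypergraph" and G :: "'b hypergraph"
  assumes M: "matching k M" and G: "kgraph k G" and "k \<ge> 1"
  shows "contains_copy M G \<longleftrightarrow> rainbow_matching (card (edges M)) (\<lambda>_. edges G)"
proof -
  let ?s = "card (edges M)"
  have finM: "finite (verts M)" "finite (edges M)"
    using M finite_subset[of "edges M" "Pow (verts M)"] unfolding matching_def kgraph_def by blast+
  have vM: "verts M = \<Union>(edges M)" and kM: "\<And>e. e \<in> edges M \<Longrightarrow> card e = k \<and> e \<subseteq> verts M"
    and pM: "pairwise disjnt (edges M)"
    using M by (auto simp: matching_def kgraph_def)
  have kG: "\<And>e. e \<in> edges G \<Longrightarrow> card e = k \<and> e \<subseteq> verts G" using G by (auto simp: kgraph_def)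
  obtain g where g: "bij_betw g {..<?s} (edges M)"
    using ex_bij_betw_nat_finite[OF finM(2)] by (auto simp: atLeast0LessThan)
  have gE: "g i \<in> edges M" if "i < ?s" for i using g that by (auto simp: bij_betw_def)
  have gdisj: "g i \<inter> g j = {}" if "i < ?s" "j < ?s" "i \<noteq> j" for i j
  proof -
    have "g i \<noteq> g j" using g that by (auto simp: bij_betw_def inj_on_def)
    then show ?thesis using pM gE that by (auto simp: pairwise_def disjnt_def)
  qed
  show ?thesis
  proof
    assume "contains_copy M G"
    then obtain H f where H: "subgraph H G" and f: "bij_betw f (verts M) (verts H)"
      "(`) f ` edges M = edges H" by (auto simp: contains_copy_def isomorphic_def)
    have "\<forall>i<?s. f ` g i \<in> edges G" using gE f(2) H by (auto simp: subgraph_def)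
    moreover have "disjoint_family_on (\<lambda>i. f ` g i) {..<?s}"
      unfolding disjoint_family_on_def
    proof (intro ballI impI)
      fix m n assume mn: "m \<in> {..<?s}" "n \<in> {..<?s}" "m \<noteq> n"
      have "f ` g m \<inter> f ` g n = f ` (g m \<inter> g n)"
        using f(1) kM gE mn by (intro inj_on_image_Int[symmetric, of f "verts M"]) (auto simp: bij_betw_def)
      then show "f ` g m \<inter> f ` g n = {}" using gdisj mn by simp
    qed
    ultimately show "rainbow_matching ?s (\<lambda>_. edges G)" by (auto simp: rainbow_matching_def)
  next
    assume "rainbow_matching ?s (\<lambda>_. edges G)"
    then obtain e where e: "\<forall>i<?s. e i \<in> edges G" "disjoint_family_on e {..<?s}"
      by (auto simp: rainbow_matching_def)
    have "\<exists>\<phi>. bij_betw \<phi> (g i) (e i)" if "i < ?s" for i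
    proof (rule finite_same_card_bij)
      show "card (g i) = card (e i)" using kM kG e gE that by metis
      show "finite (g i)" "finite (e i)"
        using kM[OF gE[OF that]] kG[of "e i"] e(1) that \<open>k \<ge> 1\<close> by (auto intro: card_ge_0_finite)
    qed
    then obtain \<phi> where \<phi>: "\<And>i. i < ?s \<Longrightarrow> bij_betw (\<phi> i) (g i) (e i)" by metis
    \<comment> \<open>Each vertex of \<open>M\<close> lies in exactly one edge, whose number selects
      the bijection to apply.\<close>
    define idx where "idx x = (THE i. i < ?s \<and> x \<in> g i)" for x
    have idx: "idx x = i" if "i < ?s" "x \<in> g i" for x i
      unfolding idx_def using that gdisj by (intro the_equality) auto
    define f where "f x = \<phi> (idx x) x" for x
    have fg: "f ` g i = e i" if "i < ?s" for i
      using \<phi>[OF that] idx that by (auto simp: f_def bij_betw_def)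
    have vg: "verts M = (\<Union>i<?s. g i)" using vM g by (auto simp: bij_betw_def)
    have "inj_on f (verts M)"
    proof (rule inj_onI)
      fix x y assume xy: "x \<in> verts M" "y \<in> verts M" "f x = f y"
      obtain i j where ij: "i < ?s" "x \<in> g i" "j < ?s" "y \<in> g j" using xy vg by auto
      have "f x \<in> e i \<inter> e j" using fg ij xy by (metis IntI imageI)
      then have "i = j" using e(2) ij by (auto simp: disjoint_family_on_def)
      then show "x = y" using xy(3) ij \<phi>[of i] idx by (auto simp: f_def bij_betw_def inj_on_def)
    qed
    moreover have "f ` verts M = (\<Union>i<?s. e i)" using fg by (auto simp: vg image_UN)
    ultimately have "bij_betw f (verts M) (\<Union>i<?s. e i)" by (simp add: bij_betw_def)
    moreover have "(`) f ` edges M = e ` {..<?s}"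
    proof -
      have "edges M = g ` {..<?s}" using g by (simp add: bij_betw_def)
      then have "(`) f ` edges M = (\<lambda>i. f ` g i) ` {..<?s}" by (metis image_image)
      then show ?thesis using fg by simp
    qed
    ultimately have "isomorphic M (Hypergraph (\<Union>i<?s. e i) (e ` {..<?s}))"
      unfolding isomorphic_def by (intro exI[of _ f]) simp
    moreover have "subgraph (Hypergraph (\<Union>i<?s. e i) (e ` {..<?s})) G"
      unfolding subgraph_def using e kG by auto
    ultimately show "contains_copy M G" unfolding contains_copy_def by blast
  qed
qed

text \<open>Images cannot create disjointness, so \<open>h\<close> need not be injective here.\<close>

lemma no_rainbow_matching_pattern:
  assumes "\<not> rainbow_matching s (\<lambda>_. B)"
  shows "\<not> rainbow_matching s (\<lambda>_. {e \<in> E. \<exists>b\<in>B. h ` b \<subseteq> e})"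
proof
  assume "rainbow_matching s (\<lambda>_. {e \<in> E. \<exists>b\<in>B. h ` b \<subseteq> e})"
  then obtain e where e: "\<forall>i<s. \<exists>b\<in>B. h ` b \<subseteq> e i" "disjoint_family_on e {..<s}"
    by (auto simp: rainbow_matching_def)
  then obtain b where b: "\<forall>i<s. b i \<in> B \<and> h ` b i \<subseteq> e i" by metis
  have "disjoint_family_on b {..<s}"
    unfolding disjoint_family_on_def
  proof (intro ballI impI)
    fix m n assume mn: "m \<in> {..<s}" "n \<in> {..<s}" "m \<noteq> n"
    then have "e m \<inter> e n = {}" "h ` b m \<subseteq> e m" "h ` b n \<subseteq> e n"
      using e(2) b by (auto simp: disjoint_family_on_def)
    then show "b m \<inter> b n = {}" by blast
  qed
  with b assms show False by (auto simp: rainbow_matching_def)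
qed

text \<open>Number the vertices of \<open>T\<close> by an initial segment of \<open>{..<L}\<close>
  and pull the traces back. The numbering is injective, so disjoint pulled-back sets would come from
  disjoint traces.\<close>

lemma matching_free_pattern:
  assumes T: "finite T" "card T \<le> L" "T \<subseteq> V" and "V \<noteq> {}"
    and free: "\<not> rainbow_matching s (\<lambda>_. (\<lambda>e. e \<inter> T) ` E)"
  obtains B h where "B \<subseteq> Pow {..<L}" "\<not> rainbow_matching s (\<lambda>_. B)" "\<And>i. h i \<in> V"
    "\<forall>e\<in>E. \<exists>b\<in>B. h ` b \<subseteq> e"
proof -
  obtain v where v: "v \<in> V" using \<open>V \<noteq> {}\<close> by auto
  obtain g where g: "bij_betw g {..<card T} T"
    using ex_bij_betw_nat_finite[OF T(1)] by (auto simp: atLeast0LessThan)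
  \<comment> \<open>Indices from \<open>card T\<close> on occur in no set \<open>tr e\<close>; the
    default \<open>v\<close> only keeps \<open>h\<close> inside \<open>V\<close>.\<close>
  define h where "h i = (if i < card T then g i else v)" for i
  define tr where "tr e = {i. i < card T \<and> g i \<in> e}" for e
  have im: "h ` tr e = e \<inter> T" for e
    using g by (auto simp: h_def tr_def bij_betw_def)
  have "\<not> rainbow_matching s (\<lambda>_. tr ` E)"
  proof
    assume "rainbow_matching s (\<lambda>_. tr ` E)"
    then obtain b where b: "\<forall>i<s. b i \<in> tr ` E" "disjoint_family_on b {..<s}"
      by (auto simp: rainbow_matching_def)
    have "\<forall>i<s. h ` b i \<in> (\<lambda>e. e \<inter> T) ` E" using b(1) im by fastforce
    moreover have "disjoint_family_on (\<lambda>i. h ` b i) {..<s}"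
      unfolding disjoint_family_on_def
    proof (intro ballI impI)
      fix m n assume mn: "m \<in> {..<s}" "n \<in> {..<s}" "m \<noteq> n"
      have "b i \<subseteq> {..<card T}" if "i < s" for i using b(1) that by (fastforce simp: tr_def)
      moreover have "inj_on h {..<card T}" using g by (auto simp: bij_betw_def h_def inj_on_def)
      ultimately have "h ` b m \<inter> h ` b n = h ` (b m \<inter> b n)"
        using mn by (intro inj_on_image_Int[symmetric]) auto
      then show "h ` b m \<inter> h ` b n = {}" using b(2) mn by (auto simp: disjoint_family_on_def)
    qed
    ultimately have "rainbow_matching s (\<lambda>_. (\<lambda>e. e \<inter> T) ` E)"
      by (intro rainbow_matchingI)
    with free show False ..
  qed
  moreover have "tr ` E \<subseteq> Pow {..<L}" using T(2) by (auto simp: tr_def)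
  moreover have "h i \<in> V" for i using g T(3) v by (auto simp: h_def bij_betw_def)
  moreover have "\<forall>e\<in>E. \<exists>b\<in>tr ` E. h ` b \<subseteq> e" proof
    fix e assume "e \<in> E"
    then show "\<exists>b\<in>tr ` E. h ` b \<subseteq> e" by (intro bexI[of _ "tr e"]) (auto simp: im)
  qed
  ultimately show ?thesis by (intro that[of "tr ` E" h])
qed

section \<open>Loop programs on the random access machine\<close>

datatype exp =
    Lit nat
  | Var nat
  | Plus exp exp
  | Minus exp exp
  | Input exp

fun eval :: "nat list \<Rightarrow> exp \<Rightarrow> (nat \<Rightarrow> nat) \<Rightarrow> nat" where
  "eval xs (Lit c) S = c"
| "eval xs (Var v) S = S v"
| "eval xs (Plus a b) S = eval xs a S + eval xs b S"
| "eval xs (Minus a b) S = eval xs a S - eval xs b S"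
| "eval xs (Input e) S = (if eval xs e S < length xs then xs ! eval xs e S else 0)"

fun vars :: "exp \<Rightarrow> nat set" where
  "vars (Lit c) = {}"
| "vars (Var v) = {v}"
| "vars (Plus a b) = vars a \<union> vars b"
| "vars (Minus a b) = vars a \<union> vars b"
| "vars (Input e) = vars e"

lemma eval_cong: "(\<And>v. v \<in> vars e \<Longrightarrow> S v = S' v) \<Longrightarrow> eval xs e S = eval xs e S'"
  by (induction e) auto

text \<open>Loops are bounded by a register, so every program terminates and its running time can be
  read off its syntax.\<close>

datatype com =
    Skip
  | Assign nat exp
  | Seq com com
  | For nat nat com

text \<open>A loop bound is read on entry. Afterwards the counter holds that bound, which is how the
  compiled loop ends, so that both agree on every variable.\<close>

fun sem :: "nat list \<Rightarrow> com \<Rightarrow> (nat \<Rightarrow> nat) \<Rightarrow> nat \<Rightarrow> nat" where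
  "sem xs Skip S = S"
| "sem xs (Assign v e) S = S(v := eval xs e S)"
| "sem xs (Seq c1 c2) S = sem xs c2 (sem xs c1 S)"
| "sem xs (For i r c) S = (fold (\<lambda>u S. sem xs c (S(i := u))) [0..<S r] S)(i := S r)"

fun writes :: "com \<Rightarrow> nat set" where
  "writes Skip = {}"
| "writes (Assign v e) = {v}"
| "writes (Seq c1 c2) = writes c1 \<union> writes c2"
| "writes (For i r c) = insert i (writes c)"

text \<open>As long as a program writes none of these registers, a bound on their initial values
  limits the number of rounds of every loop.\<close>

fun bounds :: "com \<Rightarrow> nat set" where
  "bounds Skip = {}"
| "bounds (Assign v e) = {}"
| "bounds (Seq c1 c2) = bounds c1 \<union> bounds c2"
| "bounds (For i r c) = insert r (bounds c)"

fun well_formed :: "nat \<Rightarrow> com \<Rightarrow> bool" where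
  "well_formed B Skip \<longleftrightarrow> True"
| "well_formed B (Assign v e) \<longleftrightarrow> v < B \<and> vars e \<subseteq> {..<B}"
| "well_formed B (Seq c1 c2) \<longleftrightarrow> well_formed B c1 \<and> well_formed B c2"
| "well_formed B (For i r c) \<longleftrightarrow>
     i < B \<and> r < B \<and> i \<noteq> r \<and> i \<notin> writes c \<and> r \<notin> writes c \<and> well_formed B c"

lemma fold_unwritten:
  assumes "\<And>u S. f u S v = S v"
  shows "fold f us S v = S v"
  using assms by (induction us arbitrary: S) auto

lemma sem_unwritten: "v \<notin> writes c \<Longrightarrow> sem xs c S v = S v"
  by (induction c arbitrary: S) (auto simp: fold_unwritten)

text \<open>Temporaries live in the registers from \<open>d\<close> upwards, where \<open>d\<close> exceeds every variable.\<close>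

fun compile_exp :: "exp \<Rightarrow> nat \<Rightarrow> instr list" where
  "compile_exp (Lit c) d = [Const d c]"
| "compile_exp (Var v) d = [Const d 0, Add d v d]"
| "compile_exp (Plus a b) d = compile_exp a d @ compile_exp b (Suc d) @ [Add d d (Suc d)]"
| "compile_exp (Minus a b) d = compile_exp a d @ compile_exp b (Suc d) @ [Sub d d (Suc d)]"
| "compile_exp (Input e) d = compile_exp e d @ [Read d d]"

text \<open>The instruction set has no move, so a value is copied by adding a register that holds 0.
  A loop puts 4 instructions before its body and 3 behind it, which gives the exit address
  \<open>a + length p + 7\<close>.\<close>

fun compile :: "nat \<Rightarrow> com \<Rightarrow> nat \<Rightarrow> instr list" where
  "compile B Skip a = []"
| "compile B (Assign v e) a = compile_exp e B @ [Const (Suc B) 0, Add v B (Suc B)]"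
| "compile B (Seq c1 c2) a =
     (let p = compile B c1 a in p @ compile B c2 (a + length p))"
| "compile B (For i r c) a =
     (let p = compile B c (a + 4) in
        [Const i 0, Sub B r i, JumpZero B (a + length p + 7), Const (Suc B) 0] @ p @
        [Const B 1, Add i i B, Jump (a + 1)])"

text \<open>A polynomial in a common bound on the loop registers. Each round costs the body plus 6
  steps for test and increment; 3 more steps clear the counter and leave the loop.\<close>

fun run_time :: "nat \<Rightarrow> com \<Rightarrow> nat poly" where
  "run_time B Skip = 0"
| "run_time B (Assign v e) = [:length (compile_exp e B) + 2:]"
| "run_time B (Seq c1 c2) = run_time B c1 + run_time B c2"
| "run_time B (For i r c) = pCons 3 (run_time B c + [:6:])"

section \<open>Correctness and running time of compiled programs\<close>

definition code_at :: "instr list \<Rightarrow> nat \<Rightarrow> instr list \<Rightarrow> bool" where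
  "code_at P a c \<longleftrightarrow> (\<exists>p q. P = p @ c @ q \<and> length p = a)"

lemma code_at_append:
  "code_at P a (c1 @ c2) \<longleftrightarrow> code_at P a c1 \<and> code_at P (a + length c1) c2"
proof
  assume "code_at P a (c1 @ c2)"
  then obtain p q where "P = p @ (c1 @ c2) @ q" "length p = a" by (auto simp: code_at_def)
  then have "P = p @ c1 @ (c2 @ q)" "P = (p @ c1) @ c2 @ q" "length p = a"
    "length (p @ c1) = a + length c1" by auto
  then show "code_at P a c1 \<and> code_at P (a + length c1) c2" unfolding code_at_def by blast
next
  assume "code_at P a c1 \<and> code_at P (a + length c1) c2"
  then obtain p q p' q' where *: "P = p @ c1 @ q" "length p = a" "P = p' @ c2 @ q'" "length p' = a + length c1"
    unfolding code_at_def by blast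
  then have "(p @ c1) @ q = p' @ (c2 @ q')" "length (p @ c1) = length p'" by auto
  then have "q = c2 @ q'" by (metis append_eq_append_conv)
  then show "code_at P a (c1 @ c2)" unfolding code_at_def using * by auto
qed

lemma code_at_Cons: "code_at P a (i # c) \<longleftrightarrow> code_at P a [i] \<and> code_at P (Suc a) c"
  using code_at_append[of P a "[i]" c] by simp

lemma step_code_at: "code_at P a [i] \<Longrightarrow> step P xs (a, R) = exec xs i (a, R)"
  by (auto simp: code_at_def step_def)

definition reaches :: "instr list \<Rightarrow> nat list \<Rightarrow> nat \<Rightarrow> config \<Rightarrow> config \<Rightarrow> bool" where
  "reaches P xs t c c' \<longleftrightarrow> (step P xs ^^ t) c = c'"

lemma reaches_0: "reaches P xs 0 c c"
  by (simp add: reaches_def)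

lemma reaches_trans: "reaches P xs t c c' \<Longrightarrow> reaches P xs t' c' c'' \<Longrightarrow> reaches P xs (t + t') c c''"
  by (auto simp: reaches_def funpow_add add.commute[of t])

lemma reaches_step: "code_at P a [i] \<Longrightarrow> reaches P xs 1 (a, R) (exec xs i (a, R))"
  by (simp add: reaches_def step_code_at)

lemma reaches_Suc:
  "code_at P a [i] \<Longrightarrow> reaches P xs t (exec xs i (a, R)) c \<Longrightarrow> reaches P xs (Suc t) (a, R) c"
  using reaches_trans[OF reaches_step] by fastforce

text \<open>The second operand is evaluated into \<open>Suc d\<close>, so the value of the first
  survives in \<open>d\<close>. Preservation of all registers below \<open>d\<close> is what carries
  the induction.\<close>

lemma compile_exp_correct:
  assumes "code_at P a (compile_exp e d)" "vars e \<subseteq> {..<d}"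
  shows "\<exists>R'. reaches P xs (length (compile_exp e d)) (a, R) (a + length (compile_exp e d), R') \<and>
           R' d = eval xs e R \<and> (\<forall>v<d. R' v = R v)"
  using assms
proof (induction e arbitrary: a d R)
  case (Lit c)
  then have "reaches P xs 1 (a, R) (a + 1, R(d := c))"
    using reaches_step[of P a "Const d c" xs R] by simp
  then have "reaches P xs (length (compile_exp (Lit c) d)) (a, R) (a + length (compile_exp (Lit c) d), R(d := c))"
    by simp
  moreover have "(R(d := c)) d = eval xs (Lit c) R" "\<forall>v<d. (R(d := c)) v = R v" by simp_all
  ultimately show ?case by blast
next
  case (Var v)
  then have "code_at P a [Const d 0]" "code_at P (Suc a) [Add d v d]"
    by (simp_all add: code_at_Cons[of _ _ _ "[_]"])
  then have "reaches P xs 2 (a, R) (a + 2, R(d := R v))"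
    using Var by (auto intro!: reaches_Suc reaches_0 simp: numeral_2_eq_2 reaches_def step_code_at)
  then have "reaches P xs (length (compile_exp (Var v) d)) (a, R) (a + length (compile_exp (Var v) d), R(d := R v))"
    by (simp add: numeral_2_eq_2)
  moreover have "(R(d := R v)) d = eval xs (Var v) R" "\<forall>u<d. (R(d := R v)) u = R u" by simp_all
  ultimately show ?case by blast
next
  case (Plus e1 e2)
  let ?l1 = "length (compile_exp e1 d)" and ?l2 = "length (compile_exp e2 (Suc d))"
  have sub: "vars e2 \<subseteq> {..<Suc d}" using Plus.prems(2) by auto
  from Plus.prems have c: "code_at P a (compile_exp e1 d)"
    "code_at P (a + ?l1) (compile_exp e2 (Suc d))" "code_at P (a + ?l1 + ?l2) [Add d d (Suc d)]"
    by (simp_all add: code_at_append)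
  obtain R1 where R1: "reaches P xs ?l1 (a, R) (a + ?l1, R1)" "R1 d = eval xs e1 R" "\<forall>v<d. R1 v = R v"
    using Plus.IH(1)[OF c(1), of R] Plus.prems by auto
  obtain R2 where R2: "reaches P xs ?l2 (a + ?l1, R1) (a + ?l1 + ?l2, R2)"
    "R2 (Suc d) = eval xs e2 R1" "\<forall>v<Suc d. R2 v = R1 v"
    using Plus.IH(2)[OF c(2) sub, of R1] by auto
  \<comment> \<open>The variables of \<open>e2\<close> lie below \<open>d\<close>, where evaluating
    \<open>e1\<close> changed nothing.\<close>
  have "eval xs e2 R1 = eval xs e2 R" using R1 Plus.prems by (intro eval_cong) auto
  then have "reaches P xs 1 (a + ?l1 + ?l2, R2) (Suc (a + ?l1 + ?l2), R2(d := eval xs (Plus e1 e2) R))"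
    using reaches_step[OF c(3), of xs R2] R1 R2 by simp
  from reaches_trans[OF reaches_trans[OF R1(1) R2(1)] this]
  have "reaches P xs (length (compile_exp (Plus e1 e2) d)) (a, R)
    (a + length (compile_exp (Plus e1 e2) d), R2(d := eval xs (Plus e1 e2) R))" by (simp add: add.assoc)
  moreover have "\<forall>v<d. (R2(d := eval xs (Plus e1 e2) R)) v = R v" using R1 R2 by simp
  ultimately show ?case by (metis fun_upd_same)
next
  case (Minus e1 e2)
  let ?l1 = "length (compile_exp e1 d)" and ?l2 = "length (compile_exp e2 (Suc d))"
  have sub: "vars e2 \<subseteq> {..<Suc d}" using Minus.prems(2) by auto
  from Minus.prems have c: "code_at P a (compile_exp e1 d)"
    "code_at P (a + ?l1) (compile_exp e2 (Suc d))" "code_at P (a + ?l1 + ?l2) [Sub d d (Suc d)]"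
    by (simp_all add: code_at_append)
  obtain R1 where R1: "reaches P xs ?l1 (a, R) (a + ?l1, R1)" "R1 d = eval xs e1 R" "\<forall>v<d. R1 v = R v"
    using Minus.IH(1)[OF c(1), of R] Minus.prems by auto
  obtain R2 where R2: "reaches P xs ?l2 (a + ?l1, R1) (a + ?l1 + ?l2, R2)"
    "R2 (Suc d) = eval xs e2 R1" "\<forall>v<Suc d. R2 v = R1 v"
    using Minus.IH(2)[OF c(2) sub, of R1] by auto
  have "eval xs e2 R1 = eval xs e2 R" using R1 Minus.prems by (intro eval_cong) auto
  then have "reaches P xs 1 (a + ?l1 + ?l2, R2) (Suc (a + ?l1 + ?l2), R2(d := eval xs (Minus e1 e2) R))"
    using reaches_step[OF c(3), of xs R2] R1 R2 by simp
  from reaches_trans[OF reaches_trans[OF R1(1) R2(1)] this]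
  have "reaches P xs (length (compile_exp (Minus e1 e2) d)) (a, R)
    (a + length (compile_exp (Minus e1 e2) d), R2(d := eval xs (Minus e1 e2) R))" by (simp add: add.assoc)
  moreover have "\<forall>v<d. (R2(d := eval xs (Minus e1 e2) R)) v = R v" using R1 R2 by simp
  ultimately show ?case by (metis fun_upd_same)
next
  case (Input e)
  let ?l = "length (compile_exp e d)"
  from Input.prems have c: "code_at P a (compile_exp e d)" "code_at P (a + ?l) [Read d d]"
    by (simp_all add: code_at_append)
  obtain R1 where R1: "reaches P xs ?l (a, R) (a + ?l, R1)" "R1 d = eval xs e R" "\<forall>v<d. R1 v = R v"
    using Input.IH[OF c(1), of R] Input.prems by auto
  have "reaches P xs 1 (a + ?l, R1) (Suc (a + ?l), R1(d := eval xs (Input e) R))"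
  proof -
    have "exec xs (Read d d) (a + ?l, R1) = (Suc (a + ?l), R1(d := eval xs (Input e) R))"
      using R1 by simp
    then show ?thesis using reaches_step[OF c(2), of xs R1] by metis
  qed
  from reaches_trans[OF R1(1) this]
  have "reaches P xs (length (compile_exp (Input e) d)) (a, R)
    (a + length (compile_exp (Input e) d), R1(d := eval xs (Input e) R))" by simp
  moreover have "\<forall>v<d. (R1(d := eval xs (Input e) R)) v = R v" using R1 by simp
  ultimately show ?case by (metis fun_upd_same)
qed

text \<open>Machine and semantics are compared only below \<open>B\<close>, since the temporaries
  above hold arbitrary leftovers. Unwritten loop bounds keep \<open>N\<close> valid throughout the
  run.\<close>

lemma compile_correct:
  assumes "code_at P a (compile B c a)" "well_formed B c"
    and "\<forall>v<B. R v = S v" "bounds c \<inter> writes c = {}" "\<forall>r\<in>bounds c. S r \<le> N"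
  shows "\<exists>R' t. reaches P xs t (a, R) (a + length (compile B c a), R') \<and>
           t \<le> poly (run_time B c) N \<and> (\<forall>v<B. R' v = sem xs c S v)"
  using assms
proof (induction c arbitrary: a R S)
  case Skip
  then show ?case using reaches_0 by fastforce
next
  case (Assign v e)
  let ?l = "length (compile_exp e B)"
  from Assign.prems have c: "code_at P a (compile_exp e B)"
    "code_at P (a + ?l) [Const (Suc B) 0]" "code_at P (Suc (a + ?l)) [Add v B (Suc B)]"
    by (simp_all add: code_at_append code_at_Cons[of _ _ _ "[_]"])
  obtain R1 where R1: "reaches P xs ?l (a, R) (a + ?l, R1)" "R1 B = eval xs e R" "\<forall>v<B. R1 v = R v"
    using compile_exp_correct[OF c(1), of xs R] Assign.prems(2) by auto
  have ev: "eval xs e R = eval xs e S" using Assign.prems by (intro eval_cong) auto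
  let ?R = "R1(Suc B := 0, v := eval xs e S)"
  have "reaches P xs 2 (a + ?l, R1) (a + ?l + 2, ?R)"
    using c R1 ev by (simp add: numeral_2_eq_2 reaches_def step_code_at)
  from reaches_trans[OF R1(1) this] have "reaches P xs (?l + 2) (a, R) (a + length (compile B (Assign v e) a), ?R)"
    by (simp add: add.assoc)
  moreover have "?l + 2 \<le> poly (run_time B (Assign v e)) N" by simp
  moreover have "\<forall>u<B. ?R u = sem xs (Assign v e) S u" using R1 Assign.prems by simp
  ultimately show ?case by blast
next
  case (Seq c1 c2)
  let ?l1 = "length (compile B c1 a)"
  let ?l2 = "length (compile B c2 (a + ?l1))"
  from Seq.prems have c: "code_at P a (compile B c1 a)" "code_at P (a + ?l1) (compile B c2 (a + ?l1))"
    by (simp_all add: code_at_append Let_def)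
  obtain R1 t1 where R1: "reaches P xs t1 (a, R) (a + ?l1, R1)" "t1 \<le> poly (run_time B c1) N"
    "\<forall>v<B. R1 v = sem xs c1 S v"
    using Seq.IH(1)[OF c(1) _ Seq.prems(3)] Seq.prems by auto
  have b: "bounds c2 \<inter> writes c2 = {}" "\<forall>r\<in>bounds c2. r \<notin> writes c1"
    using Seq.prems by auto
  \<comment> \<open>\<open>c1\<close> leaves the loop bounds of \<open>c2\<close> untouched, so
    \<open>N\<close> still limits them.\<close>
  then have "\<forall>r\<in>bounds c2. sem xs c1 S r \<le> N"
    using Seq.prems sem_unwritten[of _ c1 xs S] by simp
  with b obtain R2 t2 where R2: "reaches P xs t2 (a + ?l1, R1) (a + ?l1 + ?l2, R2)"
    "t2 \<le> poly (run_time B c2) N" "\<forall>v<B. R2 v = sem xs c2 (sem xs c1 S) v"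
    using Seq.IH(2)[OF c(2) _ R1(3)] Seq.prems(2) by auto
  from reaches_trans[OF R1(1) R2(1)] show ?case
    using R1 R2 by (intro exI[of _ R2] exI[of _ "t1 + t2"]) (auto simp: Let_def add.assoc)
next
  case (For i r c)
  let ?p = "compile B c (a + 4)" and ?T = "poly (run_time B c) N"
  let ?l = "length ?p"
  from For.prems have c: "code_at P a [Const i 0]" "code_at P (Suc a) [Sub B r i]"
    "code_at P (Suc (Suc a)) [JumpZero B (a + ?l + 7)]" "code_at P (Suc (Suc (Suc a))) [Const (Suc B) 0]"
    "code_at P (a + 4) ?p"
    "code_at P (a + 4 + ?l) [Const B 1]" "code_at P (Suc (a + 4 + ?l)) [Add i i B]"
    "code_at P (Suc (Suc (a + 4 + ?l))) [Jump (a + 1)]"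
    by (simp_all add: code_at_append Let_def code_at_Cons[of _ _ _ "_ # _"] code_at_Cons[of _ _ _ "_ @ _"] eval_nat_numeral)
  have wf: "i < B" "r < B" "i \<noteq> r" "i \<notin> writes c" "r \<notin> writes c" "well_formed B c"
    using For.prems by auto
  \<comment> \<open>\<open>W v\<close> is the state after \<open>v\<close> rounds, with the counter
    already set for the next test.\<close>
  define W where "W v = (fold (\<lambda>u S. sem xs c (S(i := u))) [0..<v] S)(i := v)" for v
  have W_Suc: "W (Suc v) = (sem xs c (W v))(i := Suc v)" for v
    by (simp add: W_def)
  have W_unwritten: "W v u = S u" if "u \<notin> writes c" "u \<noteq> i" for u v
    using that by (simp add: W_def fold_unwritten sem_unwritten)
  have W_i: "W v i = v" for v by (simp add: W_def)
  \<comment> \<open>Loop invariant at the test, which stands at address \<open>Suc a\<close>. The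
    leading 1 pays for clearing the counter.\<close>
  have loop: "\<exists>R' t. reaches P xs t (a, R) (Suc a, R') \<and> t \<le> 1 + v * (?T + 6) \<and> (\<forall>u<B. R' u = W v u)"
    if "v \<le> S r" for v
    using that
  proof (induction v)
    case 0
    have "reaches P xs 1 (a, R) (Suc a, R(i := 0))" using reaches_step[OF c(1), of xs R] by simp
    moreover have "\<forall>u<B. (R(i := 0)) u = W 0 u" using For.prems by (simp add: W_def)
    ultimately show ?case by (metis add_0_right mult_0 order_refl)
  next
    case (Suc v)
    then obtain R1 t1 where R1: "reaches P xs t1 (a, R) (Suc a, R1)" "t1 \<le> 1 + v * (?T + 6)"
      "\<forall>u<B. R1 u = W v u" by auto
    \<comment> \<open>While \<open>v\<close> is below the bound, the tested difference is positive
      and the body is entered.\<close>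
    have gt: "R1 r - R1 i > 0" using R1 wf W_unwritten[of r v] W_i Suc by simp
    define R1' where "R1' = R1(B := R1 r - R1 i, Suc B := 0)"
    have s1: "reaches P xs 3 (Suc a, R1) (a + 4, R1')"
      using c gt by (simp add: eval_nat_numeral reaches_def step_code_at R1'_def)
    have b: "bounds c \<inter> writes c = {}" "i \<notin> bounds c" using For.prems by auto
    have "W v u \<le> N" if "u \<in> bounds c" for u
    proof -
      have "u \<notin> writes c" "u \<noteq> i" using b that by auto
      then show ?thesis using W_unwritten[of u v] For.prems that by simp
    qed
    moreover have "\<forall>u<B. R1' u = W v u" using R1(3) by (simp add: R1'_def)
    ultimately obtain R2 t2 where R2: "reaches P xs t2 (a + 4, R1') (a + 4 + ?l, R2)" "t2 \<le> ?T"
      "\<forall>u<B. R2 u = sem xs c (W v) u"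
      using For.IH[OF c(5) wf(6), of R1' "W v"] b by auto
    let ?R3 = "R2(B := 1, i := Suc v)"
    have "R2 i = v" using R2 wf sem_unwritten[of i c xs "W v"] W_i by simp
    then have s3: "reaches P xs 3 (a + 4 + ?l, R2) (Suc a, ?R3)"
      using c wf by (simp add: eval_nat_numeral reaches_def step_code_at)
    have "reaches P xs (t1 + 3 + t2 + 3) (a, R) (Suc a, ?R3)"
      by (rule reaches_trans[OF reaches_trans[OF reaches_trans[OF R1(1) s1] R2(1)] s3])
    moreover have "t1 + 3 + t2 + 3 \<le> 1 + Suc v * (?T + 6)" using R1(2) R2(2) by simp
    moreover have "\<forall>u<B. ?R3 u = W (Suc v) u" using R2 by (auto simp: W_Suc)
    ultimately show ?case by blast
  qed
  obtain R1 t1 where R1: "reaches P xs t1 (a, R) (Suc a, R1)" "t1 \<le> 1 + S r * (?T + 6)"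
    "\<forall>u<B. R1 u = W (S r) u" using loop[of "S r"] by auto
  have "R1 r - R1 i = 0" using R1 wf W_unwritten[of r] W_i by simp
  then have "reaches P xs 2 (Suc a, R1) (a + ?l + 7, R1(B := 0))"
    using c by (simp add: numeral_2_eq_2 reaches_def step_code_at)
  from reaches_trans[OF R1(1) this]
  have "reaches P xs (t1 + 2) (a, R) (a + length (compile B (For i r c) a), R1(B := 0))"
    by (simp add: Let_def eval_nat_numeral)
  moreover have "S r * (?T + 6) \<le> N * (?T + 6)" using For.prems by (intro mult_right_mono) auto
  then have "t1 + 2 \<le> 3 + N * (?T + 6)" using R1(2) by linarith
  then have "t1 + 2 \<le> poly (run_time B (For i r c)) N" by simp
  moreover have "\<forall>v<B. (R1(B := 0)) v = sem xs (For i r c) S v" using R1 by (simp add: W_def)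
  ultimately show ?case by blast
qed

lemma halted_funpow: "length P \<le> pc \<Longrightarrow> (step P xs ^^ t) (pc, R) = (pc, R)"
  by (induction t) (auto simp: step_def)

text \<open>A halted machine stays in its configuration, so halting early is as good as halting at
  time \<open>t'\<close>.\<close>

lemma outputs_withinI:
  assumes "reaches P xs t (0, \<lambda>_. 0) (length P, R)" "t \<le> t'" "R 0 = y"
  shows "outputs_within P xs t' y"
proof -
  have "(step P xs ^^ t') (0, \<lambda>_. 0) = (step P xs ^^ (t' - t)) ((step P xs ^^ t) (0, \<lambda>_. 0))"
    using assms(2) by (metis funpow_add comp_apply le_add_diff_inverse2)
  then show ?thesis using assms by (simp add: outputs_within_def reaches_def halted_funpow)
qed

section \<open>Boolean expressions from truncated subtraction\<close>

definition esum :: "exp list \<Rightarrow> exp" where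
  "esum es = foldr Plus es (Lit 0)"

text \<open>Nonzero values stand for truth.\<close>

definition enot :: "exp \<Rightarrow> exp" where
  "enot e = Minus (Lit 1) e"

text \<open>One of the two truncated differences is positive exactly when the values differ.\<close>

definition eeq :: "exp \<Rightarrow> exp \<Rightarrow> exp" where
  "eeq a b = enot (Plus (Minus a b) (Minus b a))"

text \<open>Sums act as disjunctions, so a conjunction is the negated sum of the negations.\<close>

definition eall :: "exp list \<Rightarrow> exp" where
  "eall es = enot (esum (map enot es))"

lemma eval_esum: "eval xs (esum es) S = (\<Sum>e\<leftarrow>es. eval xs e S)"
  by (induction es) (auto simp: esum_def)

lemma eval_esum_eq_0: "eval xs (esum es) S = 0 \<longleftrightarrow> (\<forall>e\<in>set es. eval xs e S = 0)"
  by (simp add: eval_esum)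

lemma eval_enot: "eval xs (enot e) S = (if eval xs e S = 0 then 1 else 0)"
  by (auto simp: enot_def)

lemma eval_eeq: "eval xs (eeq a b) S = (if eval xs a S = eval xs b S then 1 else 0)"
  by (auto simp: eeq_def eval_enot)

lemma eval_eall: "eval xs (eall es) S = (if \<forall>e\<in>set es. eval xs e S \<noteq> 0 then 1 else 0)"
  by (simp add: eall_def eval_enot eval_esum_eq_0)

lemma vars_esum: "vars (esum es) = (\<Union>e\<in>set es. vars e)"
  by (induction es) (auto simp: esum_def)

lemma vars_enot: "vars (enot e) = vars e"
  by (simp add: enot_def)

lemma vars_eeq: "vars (eeq a b) = vars a \<union> vars b"
  by (auto simp: eeq_def vars_enot)

lemma vars_eall: "vars (eall es) = (\<Union>e\<in>set es. vars e)"
  by (auto simp: eall_def vars_enot vars_esum)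

section \<open>Enumerating kernels\<close>

definition entry :: "nat list \<Rightarrow> nat \<Rightarrow> nat" where
  "entry xs p = (if p < length xs then xs ! p else 0)"

text \<open>Two header cells precede the edges, so block \<open>j\<close> starts at cell
  \<open>2 + k * j\<close>. Index sets are lists because they are built into expressions.\<close>

definition covered :: "nat list \<Rightarrow> nat \<Rightarrow> nat list list \<Rightarrow> (nat \<Rightarrow> nat) \<Rightarrow> nat \<Rightarrow> bool" where
  "covered xs k B h j \<longleftrightarrow> (\<exists>b\<in>set B. \<forall>i\<in>set b. \<exists>t<k. h i = entry xs (2 + t + k * j))"

text \<open>This is the cost of the pair \<open>B\<close>, \<open>h\<close>: the edges that have to
  be deleted when only covered ones are kept.\<close>

definition score :: "nat list \<Rightarrow> nat \<Rightarrow> nat list list \<Rightarrow> (nat \<Rightarrow> nat) \<Rightarrow> nat \<Rightarrow> nat" where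
  "score xs k B h m = card {j. j < m \<and> \<not> covered xs k B h j}"

text \<open>Register 0 holds the least score so far, 1 and 2 the numbers of vertices and edges,
  3 a counter, 4 the index of the current edge, and \<open>5 + i\<close> the vertex \<open>h i\<close>.\<close>

definition cell :: "nat \<Rightarrow> nat \<Rightarrow> exp" where
  "cell k t = Input (Plus (Lit (2 + t)) (esum (replicate k (Var 4))))"

text \<open>The quantifiers range over \<open>B\<close>, its members and \<open>t < k\<close>, all
  fixed with the program, so they unfold into one expression of constant size.\<close>

definition uncovered :: "nat \<Rightarrow> nat list list \<Rightarrow> exp" where
  "uncovered k B = enot (esum (map (\<lambda>b. eall (map (\<lambda>i.
     esum (map (\<lambda>t. eeq (Var (5 + i)) (cell k t)) [0..<k])) b)) B))"

text \<open>Multiplication by the constant \<open>k\<close> is a sum of \<open>k\<close> copies of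
  register 4.\<close>

lemma eval_cell: "eval xs (cell k t) S = entry xs (2 + t + k * S 4)"
  by (simp add: cell_def eval_esum entry_def sum_list_replicate)

lemma eval_uncovered:
  "eval xs (uncovered k B) S = (if covered xs k B (\<lambda>i. S (5 + i)) (S 4) then 0 else 1)"
proof -
  have "eval xs (esum (map (\<lambda>t. eeq (Var (5 + i)) (cell k t)) [0..<k])) S = 0 \<longleftrightarrow>
      (\<forall>t<k. S (5 + i) \<noteq> entry xs (2 + t + k * S 4))" for i
    by (auto simp: eval_esum_eq_0 eval_eeq eval_cell)
  then show ?thesis
    by (simp add: uncovered_def eval_enot eval_esum_eq_0 eval_eall covered_def)
qed

lemma vars_uncovered: "vars (uncovered k B) \<subseteq> insert 4 ((\<lambda>i. 5 + i) ` \<Union>(set ` set B))"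
  by (auto simp: uncovered_def vars_enot vars_esum vars_eall vars_eeq cell_def)

text \<open>With truncated subtraction, \<open>a - (a - b)\<close> is the minimum of
  \<open>a\<close> and \<open>b\<close>.\<close>

definition improve :: "nat \<Rightarrow> nat list list \<Rightarrow> com" where
  "improve k B = Seq (Assign 3 (Lit 0)) (Seq (For 4 2 (Assign 3 (Plus (Var 3) (uncovered k B))))
     (Assign 0 (Minus (Var 0) (Minus (Var 0) (Var 3)))))"

lemma sem_improve:
  "sem xs (improve k B) S 0 = min (S 0) (score xs k B (\<lambda>i. S (5 + i)) (S 2))"
proof -
  let ?f = "\<lambda>u S. sem xs (Assign 3 (Plus (Var 3) (uncovered k B))) (S(4 := u))"
  \<comment> \<open>Loop invariant: register 3 counts the uncovered edges among the first
    \<open>m\<close>, and only registers 3 and 4 change.\<close>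
  have "fold ?f [0..<m] (S(3 := 0)) 3 = score xs k B (\<lambda>i. S (5 + i)) m \<and>
      (\<forall>v. v \<noteq> 3 \<and> v \<noteq> 4 \<longrightarrow> fold ?f [0..<m] (S(3 := 0)) v = S v)" for m
  proof (induction m)
    case 0
    then show ?case by (simp add: score_def)
  next
    case (Suc m)
    have "{j. j < Suc m \<and> \<not> covered xs k B h j} =
      (if covered xs k B h m then {} else {m}) \<union> {j. j < m \<and> \<not> covered xs k B h j}" for h
      by (auto simp: less_Suc_eq)
    then have "score xs k B h (Suc m) = score xs k B h m + (if covered xs k B h m then 0 else 1)" for h
      by (simp add: score_def)
    then show ?case using Suc by (simp add: eval_uncovered)
  qed
  from this[of "S 2"] show ?thesis by (simp add: improve_def min_def)
qed

section \<open>The nested search and the minimum that it computes\<close>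

text \<open>Each coordinate of \<open>h\<close> gets its own loop over the vertices, bounded by
  register 1; the list of patterns is unrolled at the innermost level.\<close>

fun search :: "nat \<Rightarrow> nat list list list \<Rightarrow> nat \<Rightarrow> com" where
  "search k Bs 0 = foldr (\<lambda>B. Seq (improve k B)) Bs Skip"
| "search k Bs (Suc l) = For (5 + l) 1 (search k Bs l)"

lemma writes_search: "writes (search k Bs l) \<subseteq> {0, 3, 4} \<union> {5..<5 + l}"
proof (induction l)
  case 0
  have "writes (foldr (\<lambda>B. Seq (improve k B)) Bs Skip) \<subseteq> {0, 3, 4}"
    by (induction Bs) (auto simp: improve_def)
  then show ?case by simp
qed auto

lemma bounds_search: "bounds (search k Bs l) \<subseteq> {1, 2}"
proof (induction l)
  case 0
  have "bounds (foldr (\<lambda>B. Seq (improve k B)) Bs Skip) \<subseteq> {1, 2}"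
    by (induction Bs) (auto simp: improve_def)
  then show ?case by simp
qed auto

lemma well_formed_search:
  assumes "\<forall>B\<in>set Bs. \<forall>b\<in>set B. set b \<subseteq> {..<L}" "l \<le> L"
  shows "well_formed (5 + L) (search k Bs l)"
  using assms(2)
proof (induction l)
  case 0
  have "well_formed (5 + L) (improve k B)" if "B \<in> set Bs" for B
    using vars_uncovered[of k B] assms(1) that by (fastforce simp: improve_def)
  then have "well_formed (5 + L) (foldr (\<lambda>B. Seq (improve k B)) Bs Skip)"
    by (induction Bs) auto
  then show ?case by simp
next
  case (Suc l)
  then show ?case using writes_search[of k Bs l] by auto
qed

text \<open>What the \<open>l\<close> innermost loops meet: they vary the first \<open>l\<close>
  coordinates, while the others stay as the registers fix them.\<close>

definition scores :: "nat list \<Rightarrow> nat \<Rightarrow> nat list list list \<Rightarrow> nat \<Rightarrow> (nat \<Rightarrow> nat) \<Rightarrow> nat set" where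
  "scores xs k Bs l S = {score xs k B h (S 2) | B h.
     B \<in> set Bs \<and> (\<forall>i<l. h i < S 1) \<and> (\<forall>i\<ge>l. h i = S (5 + i))}"

lemma scoresI:
  "B \<in> set Bs \<Longrightarrow> \<forall>i<l. h i < S 1 \<Longrightarrow> \<forall>i\<ge>l. h i = S (5 + i) \<Longrightarrow>
   score xs k B h (S 2) \<in> scores xs k Bs l S"
  unfolding scores_def by blast

lemma scores_cong:
  "S 1 = S' 1 \<Longrightarrow> S 2 = S' 2 \<Longrightarrow> (\<And>i. i \<ge> l \<Longrightarrow> S (5 + i) = S' (5 + i)) \<Longrightarrow>
   scores xs k Bs l S = scores xs k Bs l S'"
  by (simp add: scores_def cong: conj_cong)

lemma scores_0: "scores xs k Bs 0 S = (\<lambda>B. score xs k B (\<lambda>i. S (5 + i)) (S 2)) ` set Bs"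
proof -
  have "(\<forall>i. h i = S (5 + i)) \<longleftrightarrow> h = (\<lambda>i. S (5 + i))" for h by auto
  then show ?thesis by (auto simp: scores_def)
qed

text \<open>Splitting by the value of \<open>h l\<close> mirrors one round of the outermost
  loop.\<close>

lemma scores_Suc: "scores xs k Bs (Suc l) S = (\<Union>v<S 1. scores xs k Bs l (S(5 + l := v)))"
proof (intro equalityI subsetI)
  fix y assume "y \<in> scores xs k Bs (Suc l) S"
  then obtain B h where h: "y = score xs k B h (S 2)" "B \<in> set Bs" "\<forall>i<Suc l. h i < S 1"
    "\<forall>i\<ge>Suc l. h i = S (5 + i)" by (auto simp: scores_def)
  have "\<forall>i\<ge>l. h i = (S(5 + l := h l)) (5 + i)"
  proof (intro allI impI)
    fix i assume "l \<le> i"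
    then show "h i = (S(5 + l := h l)) (5 + i)" using h(4) by (cases "i = l") auto
  qed
  moreover have "\<forall>i<l. h i < (S(5 + l := h l)) 1" using h(3) by simp
  ultimately have "score xs k B h ((S(5 + l := h l)) 2) \<in> scores xs k Bs l (S(5 + l := h l))"
    using h(2) by (intro scoresI)
  then have "y \<in> scores xs k Bs l (S(5 + l := h l))" using h(1) by simp
  moreover have "h l < S 1" using h(3) by simp
  ultimately show "y \<in> (\<Union>v<S 1. scores xs k Bs l (S(5 + l := v)))" by blast
next
  fix y assume "y \<in> (\<Union>v<S 1. scores xs k Bs l (S(5 + l := v)))"
  then obtain v B h where h: "v < S 1" "y = score xs k B h (S 2)" "B \<in> set Bs" "\<forall>i<l. h i < S 1"
    "\<forall>i\<ge>l. h i = (S(5 + l := v)) (5 + i)" by (auto simp: scores_def)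
  have "h l = v" using h(5) by simp
  then have "\<forall>i<Suc l. h i < S 1" using h(1,4) by (simp add: less_Suc_eq)
  moreover have "\<forall>i\<ge>Suc l. h i = S (5 + i)" using h(5) by simp
  ultimately show "y \<in> scores xs k Bs (Suc l) S" using h(2,3) by (simp only: scoresI)
qed

lemma Min_insert_Min:
  fixes a :: "'a::linorder"
  assumes "finite A" "finite B"
  shows "Min (insert (Min (insert a A)) B) = Min (insert a (A \<union> B))"
proof (cases "A = {} \<or> B = {}")
  case False
  then show ?thesis using assms by (simp add: Min_Un min.assoc)
qed (use assms in auto)

text \<open>Finiteness is carried along in the induction because \<open>Min\<close> is meaningful
  only for finite sets.\<close>

lemma sem_search:
  "finite (scores xs k Bs l S) \<and>
   sem xs (search k Bs l) S 0 = Min (insert (S 0) (scores xs k Bs l S))"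
proof (induction l arbitrary: S)
  case 0
  have "sem xs (foldr (\<lambda>B. Seq (improve k B)) Bs Skip) S 0 =
    Min (insert (S 0) ((\<lambda>B. score xs k B (\<lambda>i. S (5 + i)) (S 2)) ` set Bs))"
  proof (induction Bs arbitrary: S)
    case (Cons B Bs)
    let ?S = "sem xs (improve k B) S"
    have "?S v = S v" if "v \<notin> {0, 3, 4}" for v
      using that by (intro sem_unwritten) (auto simp: improve_def)
    then have "sem xs (foldr (\<lambda>B. Seq (improve k B)) Bs Skip) ?S 0 =
      Min (insert (?S 0) ((\<lambda>B. score xs k B (\<lambda>i. S (5 + i)) (S 2)) ` set Bs))"
      by (simp add: Cons)
    also have "?S 0 = Min (insert (S 0) {score xs k B (\<lambda>i. S (5 + i)) (S 2)})"
      by (simp add: sem_improve)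
    finally show ?case by (simp add: Min_insert_Min del: Min_insert)
  qed simp
  then show ?case by (simp add: scores_0)
next
  case IH: (Suc l)
  \<comment> \<open>State after \<open>v\<close> rounds of the loop over coordinate
    \<open>l\<close>; its register 0 is the running minimum.\<close>
  define W where "W v = fold (\<lambda>u S. sem xs (search k Bs l) (S(5 + l := u))) [0..<v] S" for v
  have W_Suc: "W (Suc v) = sem xs (search k Bs l) ((W v)(5 + l := v))" for v
    by (simp add: W_def)
  let ?A = "\<lambda>v. \<Union>u<v. scores xs k Bs l (S(5 + l := u))"
  have fin: "finite (scores xs k Bs l S')" for S' using IH by blast
  have unwritten: "W v u = S u" if "u \<notin> {0, 3, 4} \<union> {5..<5 + Suc l}" for u v
    unfolding W_def using that writes_search[of k Bs l]
    by (intro fold_unwritten) (subst sem_unwritten, auto)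
  have "W v 0 = Min (insert (S 0) (?A v))" for v
  proof (induction v)
    case (Suc v)
    have "W (Suc v) 0 = Min (insert (W v 0) (scores xs k Bs l ((W v)(5 + l := v))))"
      by (simp only: W_Suc IH[THEN conjunct2] fun_upd_other simp_thms)
    \<comment> \<open>Once coordinate \<open>l\<close> is overwritten, earlier rounds have changed
      no register on which these scores depend.\<close>
    also have "scores xs k Bs l ((W v)(5 + l := v)) = scores xs k Bs l (S(5 + l := v))"
      by (intro scores_cong) (auto simp: unwritten)
    finally have "W (Suc v) 0 = Min (insert (Min (insert (S 0) (?A v))) (scores xs k Bs l (S(5 + l := v))))"
      by (simp only: Suc)
    also have "\<dots> = Min (insert (S 0) (?A v \<union> scores xs k Bs l (S(5 + l := v))))"
      using fin by (intro Min_insert_Min) auto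
    also have "?A v \<union> scores xs k Bs l (S(5 + l := v)) = ?A (Suc v)"
      by (auto simp: lessThan_Suc)
    finally show ?case .
  qed (simp add: W_def)
  then show ?case using fin by (simp add: scores_Suc W_def)
qed

section \<open>The list of patterns and the layout of the input\<close>

text \<open>The filter acts when the program is built, so deciding it costs no running time.\<close>

definition patterns :: "nat \<Rightarrow> nat \<Rightarrow> nat list list list" where
  "patterns s L = filter (\<lambda>B. \<not> rainbow_matching s (\<lambda>_. set ` set B)) (subseqs (subseqs [0..<L]))"

lemma patterns_bounded: "\<forall>B\<in>set (patterns s L). \<forall>b\<in>set B. set b \<subseteq> {..<L}"
proof (intro ballI)
  fix B b assume "B \<in> set (patterns s L)" "b \<in> set B"
  then have "set B \<in> set ` set (subseqs (subseqs [0..<L]))" by (auto simp: patterns_def)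
  then have "b \<in> set (subseqs [0..<L])" using \<open>b \<in> set B\<close> by (auto simp: subseqs_powset)
  then have "set b \<in> set ` set (subseqs [0..<L])" by blast
  then show "set b \<subseteq> {..<L}" by (simp add: subseqs_powset atLeast0LessThan)
qed

text \<open>The sublists of \<open>[0..<L]\<close> realize every subset of \<open>{..<L}\<close>;
  keeping those whose set lies in \<open>\<B>\<close> gives the required list.\<close>

lemma patterns_complete:
  assumes "\<B> \<subseteq> Pow {..<L}" "\<not> rainbow_matching s (\<lambda>_. \<B>)"
  obtains B where "B \<in> set (patterns s L)" "set ` set B = \<B>"
proof -
  have pow: "set ` set (subseqs [0..<L]) = Pow {..<L}"
    by (simp add: subseqs_powset atLeast0LessThan)
  have "{b \<in> set (subseqs [0..<L]). set b \<in> \<B>} \<in> set ` set (subseqs (subseqs [0..<L]))"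
    by (auto simp: subseqs_powset)
  then obtain B where B: "B \<in> set (subseqs (subseqs [0..<L]))"
    "set B = {b \<in> set (subseqs [0..<L]). set b \<in> \<B>}" by auto
  have "set ` set B = \<B> \<inter> set ` set (subseqs [0..<L])" unfolding B(2) by auto
  then have "set ` set B = \<B>" using assms(1) by (auto simp only: pow)
  then show ?thesis using that[of B] B assms(2) by (simp add: patterns_def)
qed

lemma nth_concat_uniform:
  assumes "\<forall>vs\<in>set es. length vs = k" "j < length es" "t < k"
  shows "concat es ! (t + k * j) = es ! j ! t" "t + k * j < length (concat es)"
  using assms
proof (induction es arbitrary: j)
  case (Cons vs es)
  {
    case 1
    then show ?case using Cons.IH(1)[of "j - 1"]
      by (cases j) (auto simp: nth_append)
  next
    case 2
    then show ?case using Cons.IH(2)[of "j - 1"]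
      by (cases j) auto
  }
qed auto

text \<open>An edge has \<open>k\<close> vertices, listed without repetition, so all blocks have
  length \<open>k\<close> and can be found by position.\<close>

lemma edge_list_encodingE:
  assumes "edge_list_encoding G xs" "G \<in> input_kgraphs k"
  obtains es where "bij_betw (\<lambda>j. set (es ! j)) {..<length es} (edges G)"
    "entry xs 0 = card (verts G)" "entry xs 1 = length es"
    "\<forall>j<length es. \<forall>B h. covered xs k B h j \<longleftrightarrow> (\<exists>b\<in>set B. h ` set b \<subseteq> set (es ! j))"
proof -
  obtain es where es: "distinct (map set es)" "set (map set es) = edges G" "\<forall>vs\<in>set es. distinct vs"
    "xs = card (verts G) # length es # concat es"
    using assms(1) by (auto simp: edge_list_encoding_def)
  have len: "\<forall>vs\<in>set es. length vs = k"
  proof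
    fix vs assume "vs \<in> set es"
    then have "card (set vs) = k" "distinct vs"
      using es assms(2) by (auto simp: input_kgraphs_def kgraph_def)
    then show "length vs = k" by (simp add: distinct_card)
  qed
  have "bij_betw (\<lambda>j. map set es ! j) {..<length es} (edges G)"
    using bij_betw_nth[OF es(1) _ es(2)[symmetric]] by simp
  then have "bij_betw (\<lambda>j. set (es ! j)) {..<length es} (edges G)"
    by (subst (asm) bij_betw_cong[of _ _ "\<lambda>j. set (es ! j)"]) auto
  moreover have "covered xs k B h j \<longleftrightarrow> (\<exists>b\<in>set B. h ` set b \<subseteq> set (es ! j))"
    if j: "j < length es" for B h j
  proof -
    have "entry xs (2 + t + k * j) = es ! j ! t" if "t < k" for t
      using nth_concat_uniform[OF len j that] by (simp add: entry_def es(4))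
    then have "(\<exists>t<k. y = entry xs (2 + t + k * j)) \<longleftrightarrow> y \<in> set (es ! j)" for y
      using len j by (metis in_set_conv_nth nth_mem)
    then show ?thesis by (simp add: covered_def image_subset_iff)
  qed
  ultimately show ?thesis using es(4) by (intro that[of es]) (simp_all add: entry_def)
qed

section \<open>The removal number as the least score\<close>

lemma rem_le:
  assumes "D \<subseteq> edges G" "\<not> contains_copy F (delete_edges G D)"
  shows "rem F G \<le> card D"
  unfolding rem_def by (rule Least_le) (use assms in blast)

lemma rem_attained:
  assumes "D \<subseteq> edges G" "\<not> contains_copy F (delete_edges G D)"
  obtains D' where "D' \<subseteq> edges G" "card D' = rem F G" "\<not> contains_copy F (delete_edges G D')"
proof -
  have "\<exists>D' \<subseteq> edges G. card D' = rem F G \<and> \<not> contains_copy F (delete_edges G D')"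
    unfolding rem_def by (rule LeastI_ex) (use assms in blast)
  then show ?thesis using that by (elim exE conjE)
qed

lemma contains_copy_delete_edges:
  assumes "matching k M" "kgraph k G" "k \<ge> 1"
  shows "contains_copy M (delete_edges G D) \<longleftrightarrow>
    rainbow_matching (card (edges M)) (\<lambda>_. edges G - D)"
proof -
  have "kgraph k (delete_edges G D)"
    using assms(2) by (auto simp: kgraph_def delete_edges_def)
  from contains_copy_matching_iff[OF assms(1) this assms(3)] show ?thesis
    by (simp add: delete_edges_def)
qed

text \<open>The uncovered edges of any pattern form an admissible deletion set. Conversely, a kernel
  of the graph left by an optimal deletion gives a pattern that covers every remaining edge.\<close>

lemma rem_eq_Min_scores:
  fixes M :: "'a hypergraph" and G :: "nat hypergraph"
  assumes k: "k \<ge> 1" and M: "matching k M" and s: "card (edges M) \<ge> 1"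
    and G: "G \<in> input_kgraphs k" and xs: "edge_list_encoding G xs"
    and S: "S 1 = card (verts G)" "S 2 = card (edges G)" "\<forall>i. S (5 + i) = 0"
    and L: "\<forall>E :: nat set set. (\<forall>e\<in>E. finite e \<and> card e \<le> k) \<longrightarrow>
      \<not> rainbow_matching (card (edges M)) (\<lambda>_. E) \<longrightarrow>
      (\<exists>T. finite T \<and> card T \<le> L \<and> T \<subseteq> \<Union>E \<and>
        \<not> rainbow_matching (card (edges M)) (\<lambda>_. (\<lambda>e. e \<inter> T) ` E))"
  defines "A \<equiv> scores xs k (patterns (card (edges M)) L) L S"
  shows "rem M G = Min (insert (card (edges G)) A)"
proof (rule antisym)
  let ?s = "card (edges M)"
  let ?unc = "\<lambda>B h. {e \<in> edges G. \<not> (\<exists>b\<in>set B. h ` set b \<subseteq> e)}"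
  have kG: "kgraph k G" using G by (simp add: input_kgraphs_def)
  obtain n where "verts G = {..<n}" using G unfolding input_kgraphs_def by blast
  then have V: "verts G = {..<card (verts G)}" by simp
  have finE: "finite (edges G)"
    using kG finite_subset[of "edges G" "Pow (verts G)"] unfolding kgraph_def by blast
  have finA: "finite A" using sem_search by (simp add: A_def)
  note copy = contains_copy_delete_edges[OF M kG k]
  obtain es where es: "bij_betw (\<lambda>j. set (es ! j)) {..<length es} (edges G)"
    "entry xs 0 = card (verts G)" "entry xs 1 = length es"
    "\<forall>j<length es. \<forall>B h. covered xs k B h j \<longleftrightarrow> (\<exists>b\<in>set B. h ` set b \<subseteq> set (es ! j))"
    by (rule edge_list_encodingE[OF xs G])
  have m: "length es = card (edges G)" using bij_betw_same_card[OF es(1)] by simp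
  have score: "score xs k B h (S 2) = card (?unc B h)" for B h
  proof -
    have "bij_betw (\<lambda>j. set (es ! j)) {j. j < length es \<and> \<not> covered xs k B h j} (?unc B h)"
    proof (rule bij_betw_subset[OF es(1)])
      have "edges G = (\<lambda>j. set (es ! j)) ` {..<length es}" using es(1) by (simp add: bij_betw_def)
      then show "(\<lambda>j. set (es ! j)) ` {j. j < length es \<and> \<not> covered xs k B h j} = ?unc B h"
        using es(4) by auto
    qed auto
    then show ?thesis unfolding score_def S(2) m[symmetric] by (rule bij_betw_same_card)
  qed
  \<comment> \<open>Deleting all edges is admissible because \<open>M\<close> has an edge. This
    makes the minimum in \<open>rem\<close> attained and justifies the starting value
    \<open>card (edges G)\<close>.\<close>
  have all: "\<not> contains_copy M (delete_edges G (edges G))"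
    unfolding copy using s by (auto simp: rainbow_matching_def intro: exI[of _ 0])
  show "rem M G \<le> Min (insert (card (edges G)) A)"
  proof (rule Min.boundedI)
    fix y assume "y \<in> insert (card (edges G)) A"
    then consider "y = card (edges G)" | "y \<in> A" by auto
    then show "rem M G \<le> y"
    proof cases
      case 1
      then show ?thesis using rem_le[OF order_refl all] by simp
    next
      case 2
      then obtain B h where B: "B \<in> set (patterns ?s L)" "y = card (?unc B h)"
        unfolding A_def scores_def score by blast
      have "\<not> rainbow_matching ?s (\<lambda>_. set ` set B)" using B(1) by (simp add: patterns_def)
      then have "\<not> rainbow_matching ?s (\<lambda>_. {e \<in> edges G. \<exists>b\<in>set ` set B. h ` b \<subseteq> e})"
        by (rule no_rainbow_matching_pattern)
      moreover have "edges G - ?unc B h = {e \<in> edges G. \<exists>b\<in>set ` set B. h ` b \<subseteq> e}" by auto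
      ultimately have "\<not> contains_copy M (delete_edges G (?unc B h))"
        by (simp only: copy not_False_eq_True)
      then show ?thesis unfolding B(2) by (intro rem_le) auto
    qed
  qed (use finA in auto)
  obtain D where D: "D \<subseteq> edges G" "card D = rem M G" "\<not> contains_copy M (delete_edges G D)"
    using rem_attained[OF order_refl all] by metis
  have "\<exists>y \<in> insert (card (edges G)) A. y \<le> rem M G"
  proof (cases "verts G = {}")
    case True
    \<comment> \<open>Without vertices there may be no map \<open>h\<close>, but then the starting
      value is already 0.\<close>
    then have "edges G = {}" using kG k by (fastforce simp: kgraph_def)
    then show ?thesis by simp
  next
    case False
    have sub: "\<Union>(edges G - D) \<subseteq> verts G" using kG by (auto simp: kgraph_def)
    have bounded: "\<forall>e\<in>edges G - D. finite e \<and> card e \<le> k"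
      using kG finite_subset by (fastforce simp: kgraph_def)
    have free: "\<not> rainbow_matching ?s (\<lambda>_. edges G - D)" using D(3) by (simp only: copy not_False_eq_True)
    obtain T where T: "finite T" "card T \<le> L" "T \<subseteq> \<Union>(edges G - D)"
      "\<not> rainbow_matching ?s (\<lambda>_. (\<lambda>e. e \<inter> T) ` (edges G - D))"
      using L[THEN spec, THEN mp, THEN mp, OF bounded free] by (elim exE conjE)
    obtain \<B> h where \<B>: "\<B> \<subseteq> Pow {..<L}" "\<not> rainbow_matching ?s (\<lambda>_. \<B>)" "\<And>i. h i \<in> verts G"
      "\<forall>e\<in>edges G - D. \<exists>b\<in>\<B>. h ` b \<subseteq> e"
      using matching_free_pattern[OF T(1,2) order_trans[OF T(3) sub] False T(4)] by metis
    obtain B where B: "B \<in> set (patterns ?s L)" "set ` set B = \<B>"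
      using patterns_complete[OF \<B>(1,2)] by metis
    \<comment> \<open>No loop runs over coordinates from \<open>L\<close> on, and their registers
      hold 0. Patterns use only indices below \<open>L\<close>, so the change is harmless.\<close>
    define h' where "h' i = (if i < L then h i else 0)" for i
    have "h i < card (verts G)" for i using \<B>(3)[of i] V by (metis lessThan_iff)
    then have "score xs k B h' (S 2) \<in> A" unfolding A_def
      using B(1) S by (intro scoresI) (auto simp: h'_def)
    moreover have "score xs k B h' (S 2) \<le> rem M G"
    proof -
      have im: "h' ` b = h ` b" if "b \<in> \<B>" for b
        using that \<B>(1) by (intro image_cong) (auto simp: h'_def)
      \<comment> \<open>Every edge that survives the deletion is covered, so only deleted edges can
        be uncovered.\<close>
      have "?unc B h' \<subseteq> D"
      proof
        fix e assume e: "e \<in> ?unc B h'"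
        show "e \<in> D"
        proof (rule ccontr)
          assume "e \<notin> D"
          then obtain b where "b \<in> \<B>" "h ` b \<subseteq> e" using \<B>(4) e by blast
          then show False using e im B(2) by fastforce
        qed
      qed
      then have "card (?unc B h') \<le> card D" by (rule card_mono[OF finite_subset[OF D(1) finE]])
      then show ?thesis by (simp only: score D(2))
    qed
    ultimately show ?thesis by blast
  qed
  then show "Min (insert (card (edges G)) A) \<le> rem M G"
    using finA by (meson Min_le finite_insert order_trans)
qed

section \<open>Assembling the program and its time bound\<close>

text \<open>Register 0 starts with the cost of deleting all edges.\<close>

definition prepare :: com where
  "prepare = Seq (Assign 1 (Input (Lit 0))) (Seq (Assign 2 (Input (Lit 1))) (Assign 0 (Var 2)))"

text \<open>Makes the loop over the edges polynomial in the number of vertices, which is the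
  parameter of the time bound.\<close>

lemma card_edges_le:
  assumes "kgraph k G"
  shows "card (edges G) \<le> card (verts G) ^ k"
proof -
  have fin: "finite (verts G)" using assms by (simp add: kgraph_def)
  have "card (edges G) \<le> card {e. e \<subseteq> verts G \<and> card e = k}"
    using assms fin by (intro card_mono) (auto simp: kgraph_def)
  also have "\<dots> = card (verts G) choose k" using fin by (rule n_subsets)
  also have "\<dots> \<le> card (verts G) ^ k" by (cases "k \<le> card (verts G)") (auto simp: binomial_le_pow binomial_eq_0)
  finally show ?thesis .
qed

theorem theorem1p4:
  fixes k :: nat and M :: "'a hypergraph"
  assumes "k \<ge> 2" and "matching k M"
  shows "poly_time_computable (input_kgraphs k) edge_list_encoding (\<lambda>G. card (verts G)) (rem M)"
proof (cases "edges M = {}")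
  case True
  \<comment> \<open>An edgeless \<open>M\<close> has no vertices either, so every hypergraph
    contains a copy. Then \<open>rem M G\<close> is one unspecified number for all \<open>G\<close>,
    and the program just loads it.\<close>
  have empty: "contains_copy M H" for H :: "nat hypergraph"
    using True assms(2) unfolding contains_copy_def
    by (intro exI[of _ "Hypergraph {} {}"]) (auto simp: subgraph_def isomorphic_def matching_def bij_betw_def)
  define c where "c = (LEAST r :: nat. False)"
  have rem: "rem M G = c" for G :: "nat hypergraph"
    by (simp add: rem_def empty c_def)
  have "outputs_within [Const 0 c] xs (poly [:1:] n) c" for xs n
    by (simp add: outputs_within_def step_def)
  then show ?thesis unfolding poly_time_computable_def rem by blast
next
  case False
  let ?s = "card (edges M)"
  have finM: "finite (edges M)"
    using assms(2) finite_subset[of "edges M" "Pow (verts M)"] unfolding matching_def kgraph_def by blast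
  have s: "?s \<ge> 1" using False finM by (simp add: Suc_le_eq card_gt_0_iff)
  have k: "k \<ge> 1" using assms(1) by simp
  obtain L where L: "\<forall>E :: nat set set. (\<forall>e\<in>E. finite e \<and> card e \<le> k) \<longrightarrow>
      \<not> rainbow_matching ?s (\<lambda>_. E) \<longrightarrow>
      (\<exists>T. finite T \<and> card T \<le> L \<and> T \<subseteq> \<Union>E \<and> \<not> rainbow_matching ?s (\<lambda>_. (\<lambda>e. e \<inter> T) ` E))"
    using matching_kernel[where 'a = nat and k = k and s = ?s] by (rule exE)
  let ?main = "search k (patterns ?s L) L" and ?B = "5 + L"
  define l where "l = length (compile ?B prepare 0)"
  define P where "P = compile ?B prepare 0 @ compile ?B ?main l"
  \<comment> \<open>The inner polynomial is the number of vertices plus its \<open>k\<close>-th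
    power, which bounds both registers that limit loops.\<close>
  define p where "p = run_time ?B prepare + pcompose (run_time ?B ?main) ([:0, 1:] + monom 1 k)"
  have code: "code_at P 0 (compile ?B prepare 0)" "code_at P l (compile ?B ?main l)"
    unfolding P_def code_at_def l_def by (metis append_Nil list.size(3), metis append_Nil2)
  have wf: "well_formed ?B prepare" "well_formed ?B ?main"
    using well_formed_search[OF patterns_bounded] by (simp_all add: prepare_def)
  have noclash: "bounds ?main \<inter> writes ?main = {}"
    using bounds_search[of k "patterns ?s L" L] writes_search[of k "patterns ?s L" L] by fastforce
  have "outputs_within P xs (poly p (card (verts G))) (rem M G)"
    if G: "G \<in> input_kgraphs k" and xs: "edge_list_encoding G xs" for G xs
  proof -
    have kG: "kgraph k G" using G by (simp add: input_kgraphs_def)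
    let ?N = "card (verts G) + card (verts G) ^ k"
    let ?S = "sem xs prepare (\<lambda>_. 0)"
    obtain es where "bij_betw (\<lambda>j. set (es ! j)) {..<length es} (edges G)"
      "entry xs 0 = card (verts G)" "entry xs 1 = length es"
      using edge_list_encodingE[OF xs G] by metis
    then have entries: "entry xs 0 = card (verts G)" "entry xs 1 = card (edges G)"
      using bij_betw_same_card by fastforce+
    have S: "?S 1 = card (verts G)" "?S 2 = card (edges G)" "\<forall>i. ?S (5 + i) = 0"
      "?S 0 = card (edges G)"
      using entries by (auto simp: prepare_def entry_def split: if_splits)
    have le: "\<forall>r\<in>bounds ?main. ?S r \<le> ?N"
      using bounds_search[of k "patterns ?s L" L] S card_edges_le[OF kG] by fastforce
    \<comment> \<open>\<open>prepare\<close> contains no loop, so its time bound holds for any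
      choice of \<open>N\<close>.\<close>
    obtain R1 t1 where R1: "reaches P xs t1 (0, \<lambda>_. 0) (l, R1)"
      "t1 \<le> poly (run_time ?B prepare) (card (verts G))" "\<forall>v<?B. R1 v = ?S v"
      using compile_correct[OF code(1) wf(1), of "\<lambda>_. 0" "\<lambda>_. 0" "card (verts G)" xs]
      by (auto simp: prepare_def l_def)
    obtain R2 t2 where R2: "reaches P xs t2 (l, R1) (l + length (compile ?B ?main l), R2)"
      "t2 \<le> poly (run_time ?B ?main) ?N" "\<forall>v<?B. R2 v = sem xs ?main ?S v"
      using compile_correct[OF code(2) wf(2) R1(3) noclash le, where xs = xs] by blast
    have "reaches P xs (t1 + t2) (0, \<lambda>_. 0) (length P, R2)"
      using reaches_trans[OF R1(1) R2(1)] by (simp add: P_def l_def)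
    moreover have "t1 + t2 \<le> poly p (card (verts G))"
      using R1(2) R2(2) by (simp add: p_def poly_pcompose poly_monom)
    moreover have "R2 0 = rem M G"
      using R2(3) sem_search[of xs k "patterns ?s L" L ?S] S(4)
        rem_eq_Min_scores[OF k assms(2) s G xs S(1,2,3) L] by simp
    ultimately show ?thesis by (rule outputs_withinI)
  qed
  then show ?thesis unfolding poly_time_computable_def by blast
qed

end
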